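(* To give duplicial structure to a small category $C$ is equivalently to give a left adjoint in $\mathbf{Cat}$ for the functor $p\colon C\to\Pi_1(C)$.
   Context: The category $\Pi_1(C)$ is the free groupoid on $C$: $\Pi_1$ is the left 2-adjoint of the inclusion 2-functor $\mathbf{Gpd}\hookrightarrow\mathbf{Cat}$ of groupoids in categories, and $p\colon C\to\Pi_1(C)$ is the universal functor from $C$ to a groupoid, which freely adjoins an inverse for every arrow of $C$. Duplicial structure on a small category $C$ means duplicial structure on its nerve $NC$. This is the simplicial set whose $n$-simplices are the chains $x_0\to x_1\to\dots\to x_n$ of composable morphisms of $C$, where $d_i$ omits the object $x_i$ (composing where necessary) and $s_i$ inserts an identity at $x_i$. Duplicial structure on a simplicial set $X$, with faces $d_i$ and degeneracies $s_i$, consists of maps $t_n\colon X_n\to X_n$ for all $n\geq 0$ such that, for all $n\ge 0$: (1) $d_i t_{n+1}=t_n d_{i-1}$ for $1\le i\le n+1$, and $d_0t_{n+1}=d_{n+1}$; (2) $s_it_n=t_{n+1}s_{i-1}$ for $1\le i\le n$, and $s_0t_n=t_{n+1}^2s_n$. *)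

theory Defs
  imports Main "HOL-Library.FuncSet"
begin

section \<open>Small categories\<close>

text \<open>A small category is given by carrier sets of objects and of arrows; \<open>Comp C g f\<close> is
  the composite of \<open>f\<close> followed by \<open>g\<close>.\<close>

record ('o, 'm) cat =
  Obj :: "'o set"
  Arr :: "'m set"
  Dom :: "'m \<Rightarrow> 'o"
  Cod :: "'m \<Rightarrow> 'o"
  Ide :: "'o \<Rightarrow> 'm"
  Comp :: "'m \<Rightarrow> 'm \<Rightarrow> 'm"

definition Hom :: "('o, 'm) cat \<Rightarrow> 'o \<Rightarrow> 'o \<Rightarrow> 'm set" where
  "Hom C x y = {f \<in> Arr C. Dom C f = x \<and> Cod C f = y}"

locale category =
  fixes C :: "('o, 'm) cat"
  assumes Dom_in: "f \<in> Arr C \<Longrightarrow> Dom C f \<in> Obj C"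
    and Cod_in: "f \<in> Arr C \<Longrightarrow> Cod C f \<in> Obj C"
    and Ide_in: "x \<in> Obj C \<Longrightarrow> Ide C x \<in> Hom C x x"
    and Comp_in: "f \<in> Hom C x y \<Longrightarrow> g \<in> Hom C y z \<Longrightarrow> Comp C g f \<in> Hom C x z"
    and Comp_Ide_right: "f \<in> Hom C x y \<Longrightarrow> Comp C f (Ide C x) = f"
    and Comp_Ide_left: "f \<in> Hom C x y \<Longrightarrow> Comp C (Ide C y) f = f"
    and Comp_assoc: "f \<in> Hom C w x \<Longrightarrow> g \<in> Hom C x y \<Longrightarrow> h \<in> Hom C y z \<Longrightarrow>
      Comp C h (Comp C g f) = Comp C (Comp C h g) f"

locale groupoid = category +
  assumes inverse_ex: "f \<in> Hom C x y \<Longrightarrow>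
      \<exists>g \<in> Hom C y x. Comp C g f = Ide C x \<and> Comp C f g = Ide C y"

text \<open>Functors and natural transformations are \<open>undefined\<close> outside the carriers, so that
  equality of the HOL objects is equality of functors (of natural transformations).\<close>

record ('o, 'm, 'p, 'n) cat_functor =
  On_obj :: "'o \<Rightarrow> 'p"
  On_arr :: "'m \<Rightarrow> 'n"

definition is_functor ::
    "('o, 'm) cat \<Rightarrow> ('p, 'n) cat \<Rightarrow> ('o, 'm, 'p, 'n) cat_functor \<Rightarrow> bool" where
  "is_functor C D F \<longleftrightarrow>
     On_obj F \<in> Obj C \<rightarrow>\<^sub>E Obj D \<and>
     On_arr F \<in> Arr C \<rightarrow>\<^sub>E Arr D \<and>
     (\<forall>x y. \<forall>f \<in> Hom C x y. On_arr F f \<in> Hom D (On_obj F x) (On_obj F y)) \<and>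
     (\<forall>x \<in> Obj C. On_arr F (Ide C x) = Ide D (On_obj F x)) \<and>
     (\<forall>x y z. \<forall>f \<in> Hom C x y. \<forall>g \<in> Hom C y z.
        On_arr F (Comp C g f) = Comp D (On_arr F g) (On_arr F f))"

definition id_functor :: "('o, 'm) cat \<Rightarrow> ('o, 'm, 'o, 'm) cat_functor" where
  "id_functor C = \<lparr>On_obj = (\<lambda>x \<in> Obj C. x), On_arr = (\<lambda>f \<in> Arr C. f)\<rparr>"

definition comp_functor :: "('o, 'm) cat \<Rightarrow> ('p, 'n, 'q, 'k) cat_functor \<Rightarrow>
    ('o, 'm, 'p, 'n) cat_functor \<Rightarrow> ('o, 'm, 'q, 'k) cat_functor" where
  "comp_functor C G F =
     \<lparr>On_obj = (\<lambda>x \<in> Obj C. On_obj G (On_obj F x)),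
      On_arr = (\<lambda>f \<in> Arr C. On_arr G (On_arr F f))\<rparr>"

definition nat_trans :: "('o, 'm) cat \<Rightarrow> ('p, 'n) cat \<Rightarrow> ('o, 'm, 'p, 'n) cat_functor \<Rightarrow>
    ('o, 'm, 'p, 'n) cat_functor \<Rightarrow> ('o \<Rightarrow> 'n) \<Rightarrow> bool" where
  "nat_trans C D F G \<alpha> \<longleftrightarrow>
     \<alpha> \<in> extensional (Obj C) \<and>
     (\<forall>x \<in> Obj C. \<alpha> x \<in> Hom D (On_obj F x) (On_obj G x)) \<and>
     (\<forall>x y. \<forall>f \<in> Hom C x y. Comp D (\<alpha> y) (On_arr F f) = Comp D (On_arr G f) (\<alpha> x))"

text \<open>\<open>adjunction C D l p \<eta> \<epsilon>\<close>: the functor \<open>l : D \<rightarrow> C\<close> is left adjoint to \<open>p : C \<rightarrow> D\<close> in the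
  2-category \<open>Cat\<close>, with unit \<open>\<eta>\<close> and counit \<open>\<epsilon>\<close>.\<close>

definition adjunction :: "('o, 'm) cat \<Rightarrow> ('p, 'n) cat \<Rightarrow> ('p, 'n, 'o, 'm) cat_functor \<Rightarrow>
    ('o, 'm, 'p, 'n) cat_functor \<Rightarrow> ('p \<Rightarrow> 'n) \<Rightarrow> ('o \<Rightarrow> 'm) \<Rightarrow> bool" where
  "adjunction C D l p \<eta> \<epsilon> \<longleftrightarrow>
     is_functor D C l \<and> is_functor C D p \<and>
     nat_trans D D (id_functor D) (comp_functor D p l) \<eta> \<and>
     nat_trans C C (comp_functor C l p) (id_functor C) \<epsilon> \<and>
     (\<forall>d \<in> Obj D. Comp C (\<epsilon> (On_obj l d)) (On_arr l (\<eta> d)) = Ide C (On_obj l d)) \<and>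
     (\<forall>c \<in> Obj C. Comp D (On_arr p (\<epsilon> c)) (\<eta> (On_obj p c)) = Ide D (On_obj p c))"


section \<open>The free groupoid on a category\<close>

text \<open>An arrow of the free groupoid is a class of zigzags in \<open>C\<close>. Zigzags are words in the
  arrows of \<open>C\<close> and their formal inverses, written in diagrammatic order; they are identified
  by the least congruence under which identities and composites of \<open>C\<close> are preserved and the
  formal inverses become inverses.\<close>

datatype 'm letter = Fwd 'm | Inv 'm

fun zigzag :: "('o, 'm) cat \<Rightarrow> 'o \<Rightarrow> 'm letter list \<Rightarrow> 'o \<Rightarrow> bool" where
  "zigzag C x [] y \<longleftrightarrow> x \<in> Obj C \<and> x = y"
| "zigzag C x (Fwd f # w) y \<longleftrightarrow> f \<in> Arr C \<and> Dom C f = x \<and> zigzag C (Cod C f) w y"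
| "zigzag C x (Inv f # w) y \<longleftrightarrow> f \<in> Arr C \<and> Cod C f = x \<and> zigzag C (Dom C f) w y"

inductive zz_eq :: "('o, 'm) cat \<Rightarrow> 'o \<Rightarrow> 'o \<Rightarrow> 'm letter list \<Rightarrow> 'm letter list \<Rightarrow> bool"
  for C :: "('o, 'm) cat" and x y :: 'o where
  zz_refl: "zigzag C x w y \<Longrightarrow> zz_eq C x y w w"
| zz_sym: "zz_eq C x y v w \<Longrightarrow> zz_eq C x y w v"
| zz_trans: "zz_eq C x y u v \<Longrightarrow> zz_eq C x y v w \<Longrightarrow> zz_eq C x y u w"
| zz_id: "a \<in> Obj C \<Longrightarrow> zigzag C x (u @ [Fwd (Ide C a)] @ v) y \<Longrightarrow>
    zz_eq C x y (u @ [Fwd (Ide C a)] @ v) (u @ v)"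
| zz_comp: "zigzag C x (u @ [Fwd f, Fwd g] @ v) y \<Longrightarrow>
    zz_eq C x y (u @ [Fwd f, Fwd g] @ v) (u @ [Fwd (Comp C g f)] @ v)"
| zz_FI: "zigzag C x (u @ [Fwd f, Inv f] @ v) y \<Longrightarrow>
    zz_eq C x y (u @ [Fwd f, Inv f] @ v) (u @ v)"
| zz_IF: "zigzag C x (u @ [Inv f, Fwd f] @ v) y \<Longrightarrow>
    zz_eq C x y (u @ [Inv f, Fwd f] @ v) (u @ v)"

type_synonym ('o, 'm) zz_arrow = "'o \<times> 'm letter list set \<times> 'o"

definition zz_class :: "('o, 'm) cat \<Rightarrow> 'o \<Rightarrow> 'm letter list \<Rightarrow> 'o \<Rightarrow> ('o, 'm) zz_arrow" where
  "zz_class C x w y = (x, {w'. zz_eq C x y w w'}, y)"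

definition Pi1 :: "('o, 'm) cat \<Rightarrow> ('o, ('o, 'm) zz_arrow) cat" where
  "Pi1 C =
     \<lparr>Obj = Obj C,
      Arr = {zz_class C x w y | x w y. zigzag C x w y},
      Dom = (\<lambda>(x, A, y). x),
      Cod = (\<lambda>(x, A, y). y),
      Ide = (\<lambda>x. zz_class C x [] x),
      Comp = (\<lambda>(y', B, z) (x, A, y). (x, {w. \<exists>a \<in> A. \<exists>b \<in> B. zz_eq C x z (a @ b) w}, z))\<rparr>"

definition Pi1_incl :: "('o, 'm) cat \<Rightarrow> ('o, 'm, 'o, ('o, 'm) zz_arrow) cat_functor" where
  "Pi1_incl C =
     \<lparr>On_obj = (\<lambda>x \<in> Obj C. x),
      On_arr = (\<lambda>f \<in> Arr C. zz_class C (Dom C f) [Fwd f] (Cod C f))\<rparr>"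


section \<open>Simplicial sets, nerves and duplicial structure\<close>

text \<open>\<open>Face X n i\<close> is \<open>d\<^sub>i : X\<^sub>n \<rightarrow> X\<^sub>n\<^sub>-\<^sub>1\<close> (used only for \<open>n \<ge> 1\<close>) and \<open>Degen X n i\<close> is
  \<open>s\<^sub>i : X\<^sub>n \<rightarrow> X\<^sub>n\<^sub>+\<^sub>1\<close>.\<close>

record 'x sset =
  Simplices :: "nat \<Rightarrow> 'x set"
  Face :: "nat \<Rightarrow> nat \<Rightarrow> 'x \<Rightarrow> 'x"
  Degen :: "nat \<Rightarrow> nat \<Rightarrow> 'x \<Rightarrow> 'x"

locale simplicial_set =
  fixes X :: "'x sset"
  assumes Face_in: "a \<in> Simplices X (Suc n) \<Longrightarrow> i \<le> Suc n \<Longrightarrow> Face X (Suc n) i a \<in> Simplices X n"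
    and Degen_in: "a \<in> Simplices X n \<Longrightarrow> i \<le> n \<Longrightarrow> Degen X n i a \<in> Simplices X (Suc n)"
    and Face_Face: "a \<in> Simplices X (Suc (Suc n)) \<Longrightarrow> i < j \<Longrightarrow> j \<le> Suc (Suc n) \<Longrightarrow>
      Face X (Suc n) i (Face X (Suc (Suc n)) j a)
        = Face X (Suc n) (j - 1) (Face X (Suc (Suc n)) i a)"
    and Degen_Degen: "a \<in> Simplices X n \<Longrightarrow> i \<le> j \<Longrightarrow> j \<le> n \<Longrightarrow>
      Degen X (Suc n) i (Degen X n j a) = Degen X (Suc n) (Suc j) (Degen X n i a)"
    and Face_Degen_less: "a \<in> Simplices X (Suc n) \<Longrightarrow> i < j \<Longrightarrow> j \<le> Suc n \<Longrightarrow>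
      Face X (Suc (Suc n)) i (Degen X (Suc n) j a)
        = Degen X n (j - 1) (Face X (Suc n) i a)"
    and Face_Degen_eq: "a \<in> Simplices X n \<Longrightarrow> j \<le> n \<Longrightarrow> i = j \<or> i = Suc j \<Longrightarrow>
      Face X (Suc n) i (Degen X n j a) = a"
    and Face_Degen_greater: "a \<in> Simplices X (Suc n) \<Longrightarrow> Suc j < i \<Longrightarrow> i \<le> Suc (Suc n) \<Longrightarrow>
      Face X (Suc (Suc n)) i (Degen X (Suc n) j a)
        = Degen X n j (Face X (Suc n) (i - 1) a)"

definition duplicial_structure :: "'x sset \<Rightarrow> (nat \<Rightarrow> 'x \<Rightarrow> 'x) \<Rightarrow> bool" where
  "duplicial_structure X t \<longleftrightarrow>
     (\<forall>n. t n \<in> Simplices X n \<rightarrow>\<^sub>E Simplices X n) \<and>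
     (\<forall>n. \<forall>a \<in> Simplices X (n + 1).
        (\<forall>i. 1 \<le> i \<and> i \<le> n + 1 \<longrightarrow>
           Face X (n + 1) i (t (n + 1) a) = t n (Face X (n + 1) (i - 1) a)) \<and>
        Face X (n + 1) 0 (t (n + 1) a) = Face X (n + 1) (n + 1) a) \<and>
     (\<forall>n. \<forall>a \<in> Simplices X n.
        (\<forall>i. 1 \<le> i \<and> i \<le> n \<longrightarrow>
           Degen X n i (t n a) = t (n + 1) (Degen X n (i - 1) a)) \<and>
        Degen X n 0 (t n a) = t (n + 1) (t (n + 1) (Degen X n n a)))"

text \<open>The chain \<open>x\<^sub>0 \<rightarrow> \<dots> \<rightarrow> x\<^sub>n\<close> is the pair of the list of its \<open>n + 1\<close> objects and the
  list of its \<open>n\<close> arrows; the arrow at position \<open>k\<close> goes from the object at position \<open>k\<close> to the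
  object at position \<open>k + 1\<close>.\<close>

type_synonym ('o, 'm) chain = "'o list \<times> 'm list"

definition chains :: "('o, 'm) cat \<Rightarrow> nat \<Rightarrow> ('o, 'm) chain set" where
  "chains C n = {(xs, fs). length xs = n + 1 \<and> length fs = n \<and> set xs \<subseteq> Obj C \<and>
     (\<forall>k < n. fs ! k \<in> Hom C (xs ! k) (xs ! (k + 1)))}"

definition chain_face :: "('o, 'm) cat \<Rightarrow> nat \<Rightarrow> nat \<Rightarrow> ('o, 'm) chain \<Rightarrow> ('o, 'm) chain" where
  "chain_face C n i = (\<lambda>(xs, fs).
     (take i xs @ drop (i + 1) xs,
      if i = 0 then tl fs
      else if i = n then butlast fs
      else take (i - 1) fs @ [Comp C (fs ! i) (fs ! (i - 1))] @ drop (i + 1) fs))"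

definition chain_degen :: "('o, 'm) cat \<Rightarrow> nat \<Rightarrow> ('o, 'm) chain \<Rightarrow> ('o, 'm) chain" where
  "chain_degen C i = (\<lambda>(xs, fs).
     (take (i + 1) xs @ drop i xs, take i fs @ [Ide C (xs ! i)] @ drop i fs))"

definition nerve :: "('o, 'm) cat \<Rightarrow> ('o, 'm) chain sset" where
  "nerve C = \<lparr>Simplices = chains C, Face = chain_face C, Degen = (\<lambda>n. chain_degen C)\<rparr>"


section \<open>Properties of the definitions\<close>

context category
begin

lemma Hom_ObjD: "f \<in> Hom C x y \<Longrightarrow> x \<in> Obj C \<and> y \<in> Obj C \<and> f \<in> Arr C"
  using Dom_in Cod_in by (auto simp: Hom_def)

lemma zigzag_Obj: "zigzag C x w y \<Longrightarrow> x \<in> Obj C \<and> y \<in> Obj C"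
proof (induction w arbitrary: x)
  case (Cons l w)
  then show ?case using Dom_in Cod_in by (cases l) auto
qed simp

lemma zigzag_append: "zigzag C x (u @ v) y \<longleftrightarrow> (\<exists>z. zigzag C x u z \<and> zigzag C z v y)"
proof (induction u arbitrary: x)
  case Nil
  then show ?case using zigzag_Obj by auto
next
  case (Cons l u)
  then show ?case by (cases l) auto
qed

lemma zz_eq_zigzag: "zz_eq C x y v w \<Longrightarrow> zigzag C x v y \<and> zigzag C x w y"
proof (induction rule: zz_eq.induct)
  case (zz_id a u v)
  then show ?case using Ide_in[of a] by (auto simp: zigzag_append Hom_def)
next
  case (zz_comp u f g v)
  then have "f \<in> Hom C (Dom C f) (Dom C g)" "g \<in> Hom C (Dom C g) (Cod C g)"
    by (auto simp: zigzag_append Hom_def)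
  from Comp_in[OF this] show ?case using zz_comp by (auto simp: zigzag_append Hom_def)
qed (auto simp: zigzag_append)

lemma zz_eq_prepend: "zz_eq C x y v w \<Longrightarrow> zigzag C x' u x \<Longrightarrow> zz_eq C x' y (u @ v) (u @ w)"
proof (induction rule: zz_eq.induct)
  case (zz_refl w)
  then show ?case by (intro zz_eq.zz_refl) (auto simp: zigzag_append)
next
  case (zz_sym v w)
  then show ?case by (intro zz_eq.zz_sym[OF zz_sym.IH])
next
  case (zz_trans a b c)
  then show ?case by (intro zz_eq.zz_trans[OF zz_trans.IH])
next
  case (zz_id a s v)
  then show ?case using zz_eq.zz_id[of a C x' "u @ s" v y] by (auto simp: zigzag_append)
next
  case (zz_comp s f g v)
  then show ?case using zz_eq.zz_comp[of C x' "u @ s" f g v y] by (auto simp: zigzag_append)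
next
  case (zz_FI s f v)
  then show ?case using zz_eq.zz_FI[of C x' "u @ s" f v y] by (auto simp: zigzag_append)
next
  case (zz_IF s f v)
  then show ?case using zz_eq.zz_IF[of C x' "u @ s" f v y] by (auto simp: zigzag_append)
qed

lemma zz_eq_append: "zz_eq C x y v w \<Longrightarrow> zigzag C y u y' \<Longrightarrow> zz_eq C x y' (v @ u) (w @ u)"
proof (induction rule: zz_eq.induct)
  case (zz_refl w)
  then show ?case by (intro zz_eq.zz_refl) (auto simp: zigzag_append)
next
  case (zz_sym v w)
  then show ?case by (intro zz_eq.zz_sym[OF zz_sym.IH])
next
  case (zz_trans a b c)
  then show ?case by (intro zz_eq.zz_trans[OF zz_trans.IH])
next
  case (zz_id a s v)
  then show ?case using zz_eq.zz_id[of a C x s "v @ u" y'] zigzag_append[of x "s @ Fwd (Ide C a) # v" u y'] by auto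
next
  case (zz_comp s f g v)
  then show ?case using zz_eq.zz_comp[of C x s f g "v @ u" y'] zigzag_append[of x "s @ Fwd f # Fwd g # v" u y'] by auto
next
  case (zz_FI s f v)
  then show ?case using zz_eq.zz_FI[of C x s f "v @ u" y'] zigzag_append[of x "s @ Fwd f # Inv f # v" u y'] by auto
next
  case (zz_IF s f v)
  then show ?case using zz_eq.zz_IF[of C x s f "v @ u" y'] zigzag_append[of x "s @ Inv f # Fwd f # v" u y'] by auto
qed

lemma zz_eq_cong:
  "zz_eq C x y v v' \<Longrightarrow> zz_eq C y z w w' \<Longrightarrow> zz_eq C x z (v @ w) (v' @ w')"
  by (meson zz_eq.zz_trans zz_eq_append zz_eq_prepend zz_eq_zigzag)

lemma zz_class_eq_iff:
  assumes "zigzag C x v y"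
  shows "zz_class C x v y = zz_class C x w y \<longleftrightarrow> zz_eq C x y v w"
  unfolding zz_class_def
  using assms by (auto intro: zz_eq.zz_refl zz_eq.zz_sym zz_eq.zz_trans)

lemma Hom_Pi1: "Hom (Pi1 C) x y = {zz_class C x w y | w. zigzag C x w y}"
  by (auto simp: Hom_def Pi1_def zz_class_def)

lemma Comp_Pi1:
  assumes "zigzag C x u y" "zigzag C y v z"
  shows "Comp (Pi1 C) (zz_class C y v z) (zz_class C x u y) = zz_class C x (u @ v) z"
proof -
  have "(\<exists>a. zz_eq C x y u a \<and> (\<exists>b. zz_eq C y z v b \<and> zz_eq C x z (a @ b) w)) \<longleftrightarrow>
      zz_eq C x z (u @ v) w" for w
    using assms by (meson zz_eq.zz_refl zz_eq.zz_trans zz_eq_cong)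
  then show ?thesis by (simp add: Pi1_def zz_class_def)
qed

lemma category_Pi1: "category (Pi1 C)"
proof
  fix f assume "f \<in> Arr (Pi1 C)"
  then show "Dom (Pi1 C) f \<in> Obj (Pi1 C)" "Cod (Pi1 C) f \<in> Obj (Pi1 C)"
    using zigzag_Obj by (auto simp: Pi1_def zz_class_def)
next
  fix x assume "x \<in> Obj (Pi1 C)"
  then show "Ide (Pi1 C) x \<in> Hom (Pi1 C) x x"
    unfolding Hom_Pi1 by (auto simp: Pi1_def intro!: exI[of _ "[]"])
next
  fix f g x y z assume "f \<in> Hom (Pi1 C) x y" "g \<in> Hom (Pi1 C) y z"
  then obtain v w where "f = zz_class C x v y" "zigzag C x v y"
    "g = zz_class C y w z" "zigzag C y w z"
    unfolding Hom_Pi1 by blast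
  moreover from this have "zigzag C x (v @ w) z" by (auto simp: zigzag_append)
  ultimately show "Comp (Pi1 C) g f \<in> Hom (Pi1 C) x z"
    unfolding Hom_Pi1 by (auto simp: Comp_Pi1)
next
  fix f x y assume f: "f \<in> Hom (Pi1 C) x y"
  have I: "Ide (Pi1 C) a = zz_class C a [] a" for a by (simp add: Pi1_def)
  show "Comp (Pi1 C) f (Ide (Pi1 C) x) = f" "Comp (Pi1 C) (Ide (Pi1 C) y) f = f"
    using f unfolding Hom_Pi1 I by (auto simp: Comp_Pi1 zigzag_Obj)
next
  fix f g h w x y z
  assume "f \<in> Hom (Pi1 C) w x" "g \<in> Hom (Pi1 C) x y" "h \<in> Hom (Pi1 C) y z"
  then obtain a b c where "f = zz_class C w a x" "zigzag C w a x"
    "g = zz_class C x b y" "zigzag C x b y" "h = zz_class C y c z" "zigzag C y c z"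
    unfolding Hom_Pi1 by blast
  moreover from this have "zigzag C w (a @ b) y" "zigzag C x (b @ c) z"
    by (auto simp: zigzag_append)
  ultimately show "Comp (Pi1 C) h (Comp (Pi1 C) g f) = Comp (Pi1 C) (Comp (Pi1 C) h g) f"
    by (simp add: Comp_Pi1)
qed

lemma zz_inverse:
  "zigzag C x w y \<Longrightarrow> \<exists>v. zigzag C y v x \<and> zz_eq C x x (w @ v) [] \<and> zz_eq C y y (v @ w) []"
proof (induction w arbitrary: x)
  case Nil
  then show ?case by (auto intro!: exI[of _ "[]"] zz_eq.zz_refl)
next
  case (Cons l w)
  obtain x' m where l: "zigzag C x [l] x'" "zigzag C x' w y" "zigzag C x' [m] x"
    "zz_eq C x x [l, m] []" "zz_eq C x' x' [m, l] []"
  proof (cases l)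
    case (Fwd f)
    then show ?thesis
      using Cons.prems that[of "Cod C f" "Inv f"] zz_eq.zz_FI[of C x "[]" f "[]" x]
        zz_eq.zz_IF[of C "Cod C f" "[]" f "[]" "Cod C f"] Dom_in Cod_in by auto
  next
    case (Inv f)
    then show ?thesis
      using Cons.prems that[of "Dom C f" "Fwd f"] zz_eq.zz_IF[of C x "[]" f "[]" x]
        zz_eq.zz_FI[of C "Dom C f" "[]" f "[]" "Dom C f"] Dom_in Cod_in by auto
  qed
  from Cons.IH[OF l(2)] obtain v where v: "zigzag C y v x'" "zz_eq C x' x' (w @ v) []"
    "zz_eq C y y (v @ w) []" by blast
  have "zz_eq C x x ([l] @ (w @ v) @ [m]) ([l] @ [] @ [m])"
    using v l by (intro zz_eq_prepend zz_eq_append)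
  then have 1: "zz_eq C x x ((l # w) @ (v @ [m])) []"
    using l(4) zz_eq.zz_trans by fastforce
  have "zz_eq C y y (v @ [m, l] @ w) (v @ [] @ w)"
    using v l by (intro zz_eq_prepend zz_eq_append)
  then have 2: "zz_eq C y y ((v @ [m]) @ (l # w)) []"
    using v(3) zz_eq.zz_trans by fastforce
  have "zigzag C y (v @ [m]) x" using v l by (auto simp: zigzag_append)
  with 1 2 show ?case by blast
qed

theorem groupoid_Pi1: "groupoid (Pi1 C)"
proof -
  have "\<exists>g \<in> Hom (Pi1 C) y x. Comp (Pi1 C) g f = Ide (Pi1 C) x \<and> Comp (Pi1 C) f g = Ide (Pi1 C) y"
    if f: "f \<in> Hom (Pi1 C) x y" for f x y
  proof -
    obtain w where w: "f = zz_class C x w y" "zigzag C x w y" using f unfolding Hom_Pi1 by blast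
    obtain v where v: "zigzag C y v x" "zz_eq C x x (w @ v) []" "zz_eq C y y (v @ w) []"
      using zz_inverse[OF w(2)] by blast
    have "Comp (Pi1 C) (zz_class C y v x) f = Ide (Pi1 C) x"
      "Comp (Pi1 C) f (zz_class C y v x) = Ide (Pi1 C) y"
      using w v zz_eq_zigzag zz_class_eq_iff by (auto simp: Comp_Pi1) (auto simp: Pi1_def)
    moreover have "zz_class C y v x \<in> Hom (Pi1 C) y x" unfolding Hom_Pi1 using v by blast
    ultimately show ?thesis by blast
  qed
  then show ?thesis by (simp add: groupoid_def groupoid_axioms_def category_Pi1)
qed

theorem functor_Pi1_incl: "is_functor C (Pi1 C) (Pi1_incl C)"
proof -
  have A: "zz_class C (Dom C f) [Fwd f] (Cod C f) \<in> Hom (Pi1 C) x y" if "f \<in> Hom C x y" for f x y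
    unfolding Hom_Pi1 using that Dom_in Cod_in by (auto simp: Hom_def)
  have I: "zz_class C x [Fwd (Ide C x)] x = zz_class C x [] x" if "x \<in> Obj C" for x
    using that zz_eq.zz_id[of x C x "[]" "[]" x] zz_class_eq_iff Ide_in[of x]
    by (auto simp: Hom_def)
  have K: "zz_class C x [Fwd (Comp C g f)] z =
      Comp (Pi1 C) (zz_class C y [Fwd g] z) (zz_class C x [Fwd f] y)"
    if fg: "f \<in> Hom C x y" "g \<in> Hom C y z" for f g x y z
  proof -
    have z: "zigzag C x [Fwd f] y" "zigzag C y [Fwd g] z" "zigzag C x [Fwd f, Fwd g] z"
      using fg Hom_ObjD[OF fg(1)] Hom_ObjD[OF fg(2)] by (auto simp: Hom_def)
    then have "zz_eq C x z [Fwd f, Fwd g] [Fwd (Comp C g f)]"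
      using zz_eq.zz_comp[of C x "[]" f g "[]" z] by simp
    then have "zz_class C x [Fwd f, Fwd g] z = zz_class C x [Fwd (Comp C g f)] z"
      using zz_class_eq_iff[OF z(3)] by simp
    then show ?thesis using Comp_Pi1[OF z(1,2)] by simp
  qed
  have arr: "(\<lambda>f \<in> Arr C. zz_class C (Dom C f) [Fwd f] (Cod C f)) \<in> Arr C \<rightarrow>\<^sub>E Arr (Pi1 C)"
  proof -
    have "zz_class C (Dom C f) [Fwd f] (Cod C f) \<in> Arr (Pi1 C)" if "f \<in> Arr C" for f
      using A[of f "Dom C f" "Cod C f"] that by (simp add: Hom_def)
    then show ?thesis by auto
  qed
  have on: "On_arr (Pi1_incl C) f = zz_class C x [Fwd f] y" if "f \<in> Hom C x y" for f x y
    using that by (auto simp: Pi1_incl_def Hom_def)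
  have ob: "On_obj (Pi1_incl C) x = x" if "x \<in> Obj C" for x
    using that by (simp add: Pi1_incl_def)
  show ?thesis
    unfolding is_functor_def
  proof (intro conjI allI ballI)
    show "On_obj (Pi1_incl C) \<in> Obj C \<rightarrow>\<^sub>E Obj (Pi1 C)"
      by (simp add: Pi1_incl_def Pi1_def)
    show "On_arr (Pi1_incl C) \<in> Arr C \<rightarrow>\<^sub>E Arr (Pi1 C)"
      using arr by (simp add: Pi1_incl_def)
  next
    fix x y f assume f: "f \<in> Hom C x y"
    then have "zz_class C x [Fwd f] y \<in> Hom (Pi1 C) x y"
      using A[OF f] by (simp add: Hom_def)
    then show "On_arr (Pi1_incl C) f \<in> Hom (Pi1 C) (On_obj (Pi1_incl C) x) (On_obj (Pi1_incl C) y)"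
      using Hom_ObjD[OF f] by (simp add: on[OF f] ob)
  next
    fix x assume x: "x \<in> Obj C"
    then show "On_arr (Pi1_incl C) (Ide C x) = Ide (Pi1 C) (On_obj (Pi1_incl C) x)"
      by (simp add: on[OF Ide_in] ob I) (simp add: Pi1_def)
  next
    fix x y z f g assume "f \<in> Hom C x y" "g \<in> Hom C y z"
    then show "On_arr (Pi1_incl C) (Comp C g f) =
        Comp (Pi1 C) (On_arr (Pi1_incl C) g) (On_arr (Pi1_incl C) f)"
      by (simp add: on[OF Comp_in] on K)
  qed
qed

end


text \<open>The universal property of \<open>Pi1_incl C\<close>, in its 1-dimensional and 2-dimensional parts.\<close>

definition inverse_arrow :: "('p, 'n) cat \<Rightarrow> 'n \<Rightarrow> 'n" where
  "inverse_arrow G f = (SOME g. g \<in> Hom G (Cod G f) (Dom G f) \<and>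
     Comp G g f = Ide G (Dom G f) \<and> Comp G f g = Ide G (Cod G f))"

fun zz_eval :: "('o, 'm) cat \<Rightarrow> ('p, 'n) cat \<Rightarrow> ('o, 'm, 'p, 'n) cat_functor \<Rightarrow>
    'o \<Rightarrow> 'm letter list \<Rightarrow> 'n" where
  "zz_eval C G F x [] = Ide G (On_obj F x)"
| "zz_eval C G F x (Fwd f # w) = Comp G (zz_eval C G F (Cod C f) w) (On_arr F f)"
| "zz_eval C G F x (Inv f # w) =
     Comp G (zz_eval C G F (Dom C f) w) (inverse_arrow G (On_arr F f))"

lemma (in groupoid) inverse_arrow:
  assumes "f \<in> Hom C x y"
  shows "inverse_arrow C f \<in> Hom C y x" "Comp C (inverse_arrow C f) f = Ide C x"
    "Comp C f (inverse_arrow C f) = Ide C y"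
proof -
  have "\<exists>g. g \<in> Hom C (Cod C f) (Dom C f) \<and>
     Comp C g f = Ide C (Dom C f) \<and> Comp C f g = Ide C (Cod C f)"
    using inverse_ex[OF assms] assms by (auto simp: Hom_def)
  from someI_ex[OF this] assms show "inverse_arrow C f \<in> Hom C y x"
    "Comp C (inverse_arrow C f) f = Ide C x" "Comp C f (inverse_arrow C f) = Ide C y"
    unfolding inverse_arrow_def by (auto simp: Hom_def)
qed

lemma (in category) inverse_unique:
  assumes "f \<in> Hom C x y" "g \<in> Hom C y x" "h \<in> Hom C y x"
    and "Comp C g f = Ide C x" "Comp C f h = Ide C y"
  shows "g = h"
  using Comp_assoc[OF assms(3,1,2)] Comp_Ide_right[OF assms(2)] Comp_Ide_left[OF assms(3)] assms(4,5)
  by simp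

lemma is_functorD:
  assumes "is_functor C D F"
  shows "x \<in> Obj C \<Longrightarrow> On_obj F x \<in> Obj D"
    and "f \<in> Hom C x y \<Longrightarrow> On_arr F f \<in> Hom D (On_obj F x) (On_obj F y)"
    and "x \<in> Obj C \<Longrightarrow> On_arr F (Ide C x) = Ide D (On_obj F x)"
    and "f \<in> Hom C x y \<Longrightarrow> g \<in> Hom C y z \<Longrightarrow>
      On_arr F (Comp C g f) = Comp D (On_arr F g) (On_arr F f)"
  using assms by (auto simp: is_functor_def)

locale groupoid_functor = C: category C + G: groupoid G
  for C :: "('o, 'm) cat" and G :: "('p, 'n) cat" +
  fixes F :: "('o, 'm, 'p, 'n) cat_functor"
  assumes F: "is_functor C G F"
begin

lemmas F_obj = is_functorD(1)[OF F]
lemmas F_arr = is_functorD(2)[OF F]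
lemmas F_id = is_functorD(3)[OF F]
lemmas F_comp = is_functorD(4)[OF F]

lemma arr_Hom: "f \<in> Arr C \<Longrightarrow> f \<in> Hom C (Dom C f) (Cod C f)"
  by (simp add: Hom_def)

lemma eval_Hom: "zigzag C x w y \<Longrightarrow> zz_eval C G F x w \<in> Hom G (On_obj F x) (On_obj F y)"
proof (induction w arbitrary: x)
  case Nil
  then show ?case using F_obj G.Ide_in by auto
next
  case (Cons l w)
  show ?case
  proof (cases l)
    case (Fwd f)
    then show ?thesis using Cons F_arr[OF arr_Hom] G.Comp_in by fastforce
  next
    case (Inv f)
    then show ?thesis
      using Cons G.inverse_arrow(1)[OF F_arr[OF arr_Hom]] G.Comp_in by fastforce
  qed
qed

lemma eval_append:
  "zigzag C x u z \<Longrightarrow> zigzag C z v y \<Longrightarrow>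
    zz_eval C G F x (u @ v) = Comp G (zz_eval C G F z v) (zz_eval C G F x u)"
proof (induction u arbitrary: x)
  case Nil
  then show ?case using G.Comp_Ide_right[OF eval_Hom[OF Nil(2)]] by simp
next
  case (Cons l u)
  show ?case
  proof (cases l)
    case (Fwd f)
    then have "On_arr F f \<in> Hom G (On_obj F x) (On_obj F (Cod C f))" "zigzag C (Cod C f) u z"
      using Cons.prems F_arr[OF arr_Hom, of f] by auto
    from G.Comp_assoc[OF this(1) eval_Hom[OF this(2)] eval_Hom[OF Cons.prems(2)]]
      Cons.IH[OF this(2) Cons.prems(2)] Fwd show ?thesis by simp
  next
    case (Inv f)
    then have "inverse_arrow G (On_arr F f) \<in> Hom G (On_obj F x) (On_obj F (Dom C f))"
      "zigzag C (Dom C f) u z"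
      using Cons.prems G.inverse_arrow(1)[OF F_arr[OF arr_Hom, of f]] by auto
    from G.Comp_assoc[OF this(1) eval_Hom[OF this(2)] eval_Hom[OF Cons.prems(2)]]
      Cons.IH[OF this(2) Cons.prems(2)] Inv show ?thesis by simp
  qed
qed

lemma eval_middle:
  assumes "zigzag C x u a" "zigzag C a m b" "zigzag C a m' b" "zigzag C b v y"
    and "zz_eval C G F a m = zz_eval C G F a m'"
  shows "zz_eval C G F x (u @ m @ v) = zz_eval C G F x (u @ m' @ v)"
proof -
  have "zigzag C a (m @ v) y" "zigzag C a (m' @ v) y"
    using assms by (auto simp: C.zigzag_append)
  then show ?thesis
    using eval_append[OF assms(1)] eval_append[OF assms(2,4)] eval_append[OF assms(3,4)] assms(5)
    by metis
qed

lemma eval_zz_eq: "zz_eq C x y v w \<Longrightarrow> zz_eval C G F x v = zz_eval C G F x w"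
proof (induction rule: zz_eq.induct)
  case (zz_id a u v)
  then have z: "zigzag C x u a" "zigzag C a [Fwd (Ide C a)] a" "zigzag C a [] a" "zigzag C a v y"
    using C.Ide_in[of a] by (auto simp: C.zigzag_append Hom_def)
  have "zz_eval C G F a [Fwd (Ide C a)] = zz_eval C G F a []"
    using C.Ide_in[OF zz_id(1)] G.Comp_Ide_left[OF G.Ide_in[OF F_obj[OF zz_id(1)]]] zz_id(1)
    by (simp add: F_id Hom_def)
  from eval_middle[OF z this] show ?case by simp
next
  case (zz_comp u f g v)
  let ?a = "Dom C f" and ?b = "Cod C f" and ?c = "Cod C g"
  have f: "f \<in> Hom C ?a ?b" and g: "g \<in> Hom C ?b ?c"
    using zz_comp by (auto simp: C.zigzag_append Hom_def)
  note gf = C.Comp_in[OF f g]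
  have z: "zigzag C x u ?a" "zigzag C ?a [Fwd f, Fwd g] ?c" "zigzag C ?c v y"
    using zz_comp C.Cod_in by (auto simp: C.zigzag_append)
  have z': "zigzag C ?a [Fwd (Comp C g f)] ?c"
    using gf C.Hom_ObjD[OF gf] by (auto simp: Hom_def)
  have "zz_eval C G F ?a [Fwd f, Fwd g] = zz_eval C G F ?a [Fwd (Comp C g f)]"
    using G.Comp_assoc[OF F_arr[OF f] F_arr[OF g] G.Ide_in[OF F_obj]] C.Hom_ObjD[OF g]
      F_comp[OF f g] gf by (simp add: Hom_def)
  from eval_middle[OF z(1,2) z' z(3) this] show ?case by simp
next
  case (zz_FI u f v)
  let ?a = "Dom C f" and ?b = "Cod C f"
  have f: "f \<in> Hom C ?a ?b"
    using zz_FI by (auto simp: C.zigzag_append Hom_def)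
  note i = G.inverse_arrow[OF F_arr[OF f]]
  have z: "zigzag C x u ?a" "zigzag C ?a [Fwd f, Inv f] ?a" "zigzag C ?a [] ?a" "zigzag C ?a v y"
    using zz_FI C.Dom_in by (auto simp: C.zigzag_append)
  have "zz_eval C G F ?a [Fwd f, Inv f] = zz_eval C G F ?a []"
    using G.Comp_Ide_left[OF i(1)] i by simp
  from eval_middle[OF z this] show ?case by simp
next
  case (zz_IF u f v)
  let ?a = "Dom C f" and ?b = "Cod C f"
  have f: "f \<in> Hom C ?a ?b"
    using zz_IF by (auto simp: C.zigzag_append Hom_def)
  note i = G.inverse_arrow[OF F_arr[OF f]]
  have z: "zigzag C x u ?b" "zigzag C ?b [Inv f, Fwd f] ?b" "zigzag C ?b [] ?b" "zigzag C ?b v y"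
    using zz_IF C.Cod_in by (auto simp: C.zigzag_append)
  have "zz_eval C G F ?b [Inv f, Fwd f] = zz_eval C G F ?b []"
    using G.Comp_Ide_left[OF F_arr[OF f]] i by simp
  from eval_middle[OF z this] show ?case by simp
qed simp_all

definition lift :: "('o, ('o, 'm) zz_arrow, 'p, 'n) cat_functor" where
  "lift = \<lparr>On_obj = On_obj F,
     On_arr = (\<lambda>a \<in> Arr (Pi1 C). zz_eval C G F (fst a) (SOME w. w \<in> fst (snd a)))\<rparr>"

lemma lift_class:
  assumes "zigzag C x w y"
  shows "On_arr lift (zz_class C x w y) = zz_eval C G F x w"
proof -
  have "zz_eq C x y w (SOME w'. zz_eq C x y w w')"
    using someI[of "zz_eq C x y w", OF zz_refl[OF assms]] .
  moreover have "zz_class C x w y \<in> Arr (Pi1 C)" using assms by (auto simp: Pi1_def)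
  ultimately show ?thesis using eval_zz_eq by (simp add: lift_def zz_class_def)
qed

lemma lift_functor: "is_functor (Pi1 C) G lift"
  unfolding is_functor_def
proof (intro conjI allI ballI)
  show "On_obj lift \<in> Obj (Pi1 C) \<rightarrow>\<^sub>E Obj G"
    using F by (simp add: lift_def Pi1_def is_functor_def)
  have "On_arr lift a \<in> Arr G" if "a \<in> Arr (Pi1 C)" for a
    using that eval_Hom by (auto simp: Pi1_def lift_class Hom_def)
  then show "On_arr lift \<in> Arr (Pi1 C) \<rightarrow>\<^sub>E Arr G"
    by (auto simp: lift_def)
next
  fix x y f assume "f \<in> Hom (Pi1 C) x y"
  then show "On_arr lift f \<in> Hom G (On_obj lift x) (On_obj lift y)"
    unfolding C.Hom_Pi1 using eval_Hom by (auto simp: lift_class) (simp add: lift_def)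
next
  fix x assume "x \<in> Obj (Pi1 C)"
  then show "On_arr lift (Ide (Pi1 C) x) = Ide G (On_obj lift x)"
    using lift_class[of x "[]" x] by (simp add: Pi1_def) (simp add: lift_def)
next
  fix x y z f g assume "f \<in> Hom (Pi1 C) x y" "g \<in> Hom (Pi1 C) y z"
  then obtain v w where "f = zz_class C x v y" "zigzag C x v y"
    "g = zz_class C y w z" "zigzag C y w z"
    unfolding C.Hom_Pi1 by blast
  moreover from this have "zigzag C x (v @ w) z" by (auto simp: C.zigzag_append)
  ultimately show "On_arr lift (Comp (Pi1 C) g f) = Comp G (On_arr lift g) (On_arr lift f)"
    by (simp add: C.Comp_Pi1 lift_class eval_append)
qed

lemma lift_incl: "comp_functor C lift (Pi1_incl C) = F"
proof -
  have "On_arr lift (zz_class C (Dom C f) [Fwd f] (Cod C f)) = On_arr F f" if "f \<in> Arr C" for f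
    using lift_class[of "Dom C f" "[Fwd f]" "Cod C f"] that C.Cod_in[OF that]
      G.Comp_Ide_left[OF F_arr[OF arr_Hom[OF that]]] by simp
  moreover have "On_obj F \<in> extensional (Obj C)" "On_arr F \<in> extensional (Arr C)"
    using F by (auto simp: is_functor_def PiE_def)
  ultimately have "(\<lambda>x \<in> Obj C. On_obj F x) = On_obj F"
    "(\<lambda>f \<in> Arr C. On_arr lift (zz_class C (Dom C f) [Fwd f] (Cod C f))) = On_arr F"
    by (auto intro!: ext simp: restrict_def extensional_def)
  moreover have "On_obj lift = On_obj F" by (simp add: lift_def)
  ultimately show ?thesis
    unfolding comp_functor_def Pi1_incl_def
    by (intro cat_functor.equality) (simp_all cong: restrict_cong)
qed

end

lemma (in category) Pi1_hom_induct:
  assumes a: "a \<in> Hom (Pi1 C) x y"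
    and id: "\<And>x. x \<in> Obj C \<Longrightarrow> P x x (Ide (Pi1 C) x)"
    and comp: "\<And>x y z a b. a \<in> Hom (Pi1 C) x y \<Longrightarrow> b \<in> Hom (Pi1 C) y z \<Longrightarrow>
      P x y a \<Longrightarrow> P y z b \<Longrightarrow> P x z (Comp (Pi1 C) b a)"
    and incl: "\<And>x y f. f \<in> Hom C x y \<Longrightarrow> P x y (On_arr (Pi1_incl C) f)"
    and inv: "\<And>x y f a. f \<in> Hom C x y \<Longrightarrow> a \<in> Hom (Pi1 C) y x \<Longrightarrow>
      Comp (Pi1 C) a (On_arr (Pi1_incl C) f) = Ide (Pi1 C) x \<Longrightarrow>
      Comp (Pi1 C) (On_arr (Pi1_incl C) f) a = Ide (Pi1 C) y \<Longrightarrow> P y x a"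
  shows "P x y a"
proof -
  have on: "On_arr (Pi1_incl C) f = zz_class C x [Fwd f] y" if "f \<in> Hom C x y" for f x y
    using that by (auto simp: Pi1_incl_def Hom_def)
  have Iz: "Ide (Pi1 C) x = zz_class C x [] x" for x by (simp add: Pi1_def)
  have "P x y (zz_class C x w y)" if "zigzag C x w y" for w
    using that
  proof (induction w arbitrary: x)
    case Nil
    then show ?case using id by (auto simp: Iz)
  next
    case (Cons l w)
    have "\<exists>z. zigzag C x [l] z \<and> zigzag C z w y \<and> P x z (zz_class C x [l] z)"
    proof (cases l)
      case (Fwd f)
      then have "f \<in> Hom C x (Cod C f)" using Cons.prems by (simp add: Hom_def)
      then show ?thesis using incl on Fwd Cons.prems Cod_in by fastforce
    next
      case (Inv f)
      then have f: "f \<in> Hom C (Dom C f) x" using Cons.prems by (auto simp: Hom_def)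
      have zi: "zigzag C x [Inv f] (Dom C f)" "zigzag C (Dom C f) [Fwd f] x"
        using Inv Cons.prems Hom_ObjD[OF f] by auto
      then have "zigzag C x [Inv f, Fwd f] x" "zigzag C (Dom C f) [Fwd f, Inv f] (Dom C f)"
        by auto
      then have "zz_class C x [Inv f, Fwd f] x = zz_class C x [] x"
        "zz_class C (Dom C f) [Fwd f, Inv f] (Dom C f) = zz_class C (Dom C f) [] (Dom C f)"
        using zz_IF[of C x "[]" f "[]" x] zz_FI[of C "Dom C f" "[]" f "[]" "Dom C f"]
        by (auto simp: zz_class_eq_iff)
      then have "P x (Dom C f) (zz_class C x [Inv f] (Dom C f))"
        using zi by (intro inv[OF f]) (auto simp: on[OF f] Comp_Pi1 Iz Hom_Pi1)
      then show ?thesis using Inv zi Cons.prems by auto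
    qed
    then obtain z where z: "zigzag C x [l] z" "zigzag C z w y" "P x z (zz_class C x [l] z)"
      by blast
    have "P x y (Comp (Pi1 C) (zz_class C z w y) (zz_class C x [l] z))"
      using z Cons.IH[OF z(2)] by (intro comp) (auto simp: Hom_Pi1)
    then show ?case using z by (simp add: Comp_Pi1)
  qed
  then show ?thesis using a unfolding Hom_Pi1 by blast
qed

theorem Pi1_universal:
  assumes "category C" "groupoid G" "is_functor C G F"
  shows "\<exists>!F'. is_functor (Pi1 C) G F' \<and> comp_functor C F' (Pi1_incl C) = F"
proof -
  interpret groupoid_functor C G F
    using assms by (simp add: groupoid_functor_def groupoid_functor_axioms_def)
  interpret P: category "Pi1 C" by (rule C.category_Pi1)
  have "F1 = F2" if F1: "is_functor (Pi1 C) G F1" "comp_functor C F1 (Pi1_incl C) = F"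
    and F2: "is_functor (Pi1 C) G F2" "comp_functor C F2 (Pi1_incl C) = F" for F1 F2
  proof -
    have e: "comp_functor C F1 (Pi1_incl C) = comp_functor C F2 (Pi1_incl C)"
      using F1 F2 by simp
    have ob: "On_obj F1 x = On_obj F2 x" if "x \<in> Obj C" for x
      using that fun_cong[OF arg_cong[OF e, of On_obj], of x]
      by (simp add: comp_functor_def Pi1_incl_def)
    have ar: "On_arr F1 (On_arr (Pi1_incl C) f) = On_arr F2 (On_arr (Pi1_incl C) f)"
      if "f \<in> Arr C" for f
      using that fun_cong[OF arg_cong[OF e, of On_arr], of f]
      by (simp add: comp_functor_def)
    have *: "On_arr F1 a = On_arr F2 a" if "a \<in> Hom (Pi1 C) x y" for a x y
      using that
    proof (rule C.Pi1_hom_induct[where P = "\<lambda>_ _ a. On_arr F1 a = On_arr F2 a"])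
      fix x assume "x \<in> Obj C"
      then show "On_arr F1 (Ide (Pi1 C) x) = On_arr F2 (Ide (Pi1 C) x)"
        using is_functorD(3)[OF F1(1)] is_functorD(3)[OF F2(1)] ob by (simp add: Pi1_def)
    next
      fix x y z a b assume "a \<in> Hom (Pi1 C) x y" "b \<in> Hom (Pi1 C) y z"
        "On_arr F1 a = On_arr F2 a" "On_arr F1 b = On_arr F2 b"
      then show "On_arr F1 (Comp (Pi1 C) b a) = On_arr F2 (Comp (Pi1 C) b a)"
        using is_functorD(4)[OF F1(1)] is_functorD(4)[OF F2(1)] by simp
    next
      fix x y f assume "f \<in> Hom C x y"
      then show "On_arr F1 (On_arr (Pi1_incl C) f) = On_arr F2 (On_arr (Pi1_incl C) f)"
        using ar by (simp add: Hom_def)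
    next
      fix x y f a assume f: "f \<in> Hom C x y" and a: "a \<in> Hom (Pi1 C) y x"
        and i: "Comp (Pi1 C) a (On_arr (Pi1_incl C) f) = Ide (Pi1 C) x"
          "Comp (Pi1 C) (On_arr (Pi1_incl C) f) a = Ide (Pi1 C) y"
      let ?p = "On_arr (Pi1_incl C) f"
      have xy: "x \<in> Obj C" "y \<in> Obj C" "f \<in> Arr C" using C.Hom_ObjD[OF f] by auto
      have p: "?p \<in> Hom (Pi1 C) x y"
        using is_functorD(2)[OF C.functor_Pi1_incl f] xy by (simp add: Pi1_incl_def)
      have o: "Obj (Pi1 C) = Obj C" by (simp add: Pi1_def)
      have "Comp G (On_arr F1 a) (On_arr F1 ?p) = Ide G (On_obj F1 x)"
        using is_functorD(3,4)[OF F1(1)] p a i xy o by metis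
      moreover have "Comp G (On_arr F2 ?p) (On_arr F2 a) = Ide G (On_obj F2 y)"
        using is_functorD(3,4)[OF F2(1)] p a i xy o by metis
      ultimately show "On_arr F1 a = On_arr F2 a"
        using G.inverse_unique[of "On_arr F1 ?p" "On_obj F1 x" "On_obj F1 y"
            "On_arr F1 a" "On_arr F2 a"]
          is_functorD(2)[OF F1(1) p] is_functorD(2)[OF F1(1) a] is_functorD(2)[OF F2(1) a]
          ob xy ar by simp
    qed
    have ar': "On_arr F1 a = On_arr F2 a" if "a \<in> Arr (Pi1 C)" for a
      using *[of a "Dom (Pi1 C) a" "Cod (Pi1 C) a"] that by (simp add: Hom_def)
    have E: "On_arr F1 \<in> Arr (Pi1 C) \<rightarrow>\<^sub>E Arr G" "On_arr F2 \<in> Arr (Pi1 C) \<rightarrow>\<^sub>E Arr G"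
      "On_obj F1 \<in> Obj C \<rightarrow>\<^sub>E Obj G" "On_obj F2 \<in> Obj C \<rightarrow>\<^sub>E Obj G"
      using F1(1) F2(1) by (simp_all add: is_functor_def) (simp_all add: Pi1_def)
    have "On_arr F1 = On_arr F2" "On_obj F1 = On_obj F2"
      using PiE_ext[OF E(1,2) ar'] PiE_ext[OF E(3,4) ob] by blast+
    then show ?thesis by (intro cat_functor.equality) auto
  qed
  then show ?thesis using lift_functor lift_incl by blast
qed

theorem Pi1_universal_2cells:
  assumes "category C" "category D" "is_functor (Pi1 C) D F" "is_functor (Pi1 C) D G"
    and "nat_trans C D (comp_functor C F (Pi1_incl C)) (comp_functor C G (Pi1_incl C)) \<alpha>"
  shows "\<exists>!\<beta>. nat_trans (Pi1 C) D F G \<beta> \<and> (\<forall>x \<in> Obj C. \<beta> (On_obj (Pi1_incl C) x) = \<alpha> x)"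
proof -
  interpret C: category C by fact
  interpret D: category D by fact
  interpret P: category "Pi1 C" by (rule C.category_Pi1)
  note F = is_functorD[OF assms(3)] and G = is_functorD[OF assms(4)]
  have o: "Obj (Pi1 C) = Obj C" by (simp add: Pi1_def)
  have al: "\<alpha> x \<in> Hom D (On_obj F x) (On_obj G x)" if "x \<in> Obj C" for x
    using assms(5) that by (auto simp: nat_trans_def comp_functor_def Pi1_incl_def)
  have nat: "Comp D (\<alpha> y) (On_arr F a) = Comp D (On_arr G a) (\<alpha> x)"
    if "a \<in> Hom (Pi1 C) x y" for a x y
    using that
  proof (rule C.Pi1_hom_induct[where
        P = "\<lambda>x y a. Comp D (\<alpha> y) (On_arr F a) = Comp D (On_arr G a) (\<alpha> x)"])
    fix x assume "x \<in> Obj C"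
    then show "Comp D (\<alpha> x) (On_arr F (Ide (Pi1 C) x)) = Comp D (On_arr G (Ide (Pi1 C) x)) (\<alpha> x)"
      using F(3) G(3) o D.Comp_Ide_left[OF al] D.Comp_Ide_right[OF al] by simp
  next
    fix x y z a b assume a: "a \<in> Hom (Pi1 C) x y" and b: "b \<in> Hom (Pi1 C) y z"
      and IH: "Comp D (\<alpha> y) (On_arr F a) = Comp D (On_arr G a) (\<alpha> x)"
        "Comp D (\<alpha> z) (On_arr F b) = Comp D (On_arr G b) (\<alpha> y)"
    have xyz: "x \<in> Obj C" "y \<in> Obj C" "z \<in> Obj C"
      using P.Hom_ObjD[OF a] P.Hom_ObjD[OF b] o by auto
    have "Comp D (\<alpha> z) (On_arr F (Comp (Pi1 C) b a)) =
        Comp D (Comp D (\<alpha> z) (On_arr F b)) (On_arr F a)"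
      by (simp only: F(4)[OF a b] D.Comp_assoc[OF F(2)[OF a] F(2)[OF b] al[OF xyz(3)]])
    also have "\<dots> = Comp D (On_arr G b) (Comp D (\<alpha> y) (On_arr F a))"
      by (simp only: IH(2) D.Comp_assoc[OF F(2)[OF a] al[OF xyz(2)] G(2)[OF b]])
    also have "\<dots> = Comp D (On_arr G (Comp (Pi1 C) b a)) (\<alpha> x)"
      by (simp only: IH(1) G(4)[OF a b] D.Comp_assoc[OF al[OF xyz(1)] G(2)[OF a] G(2)[OF b]])
    finally show "Comp D (\<alpha> z) (On_arr F (Comp (Pi1 C) b a)) =
        Comp D (On_arr G (Comp (Pi1 C) b a)) (\<alpha> x)" .
  next
    fix x y f assume f: "f \<in> Hom C x y"
    then have "f \<in> Arr C" using C.Hom_ObjD by auto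
    moreover have "Comp D (\<alpha> y) (On_arr (comp_functor C F (Pi1_incl C)) f) =
        Comp D (On_arr (comp_functor C G (Pi1_incl C)) f) (\<alpha> x)"
      using assms(5) f unfolding nat_trans_def by blast
    ultimately show "Comp D (\<alpha> y) (On_arr F (On_arr (Pi1_incl C) f)) =
        Comp D (On_arr G (On_arr (Pi1_incl C) f)) (\<alpha> x)"
      by (simp add: comp_functor_def)
    then have nf: "Comp D (\<alpha> y) (On_arr F (On_arr (Pi1_incl C) f)) =
        Comp D (On_arr G (On_arr (Pi1_incl C) f)) (\<alpha> x)" .
    fix a assume a: "a \<in> Hom (Pi1 C) y x"
      and i: "Comp (Pi1 C) a (On_arr (Pi1_incl C) f) = Ide (Pi1 C) x"
        "Comp (Pi1 C) (On_arr (Pi1_incl C) f) a = Ide (Pi1 C) y"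
    let ?p = "On_arr (Pi1_incl C) f"
    have xy: "x \<in> Obj C" "y \<in> Obj C" using C.Hom_ObjD[OF f] by auto
    have p: "?p \<in> Hom (Pi1 C) x y"
      using is_functorD(2)[OF C.functor_Pi1_incl f] xy by (simp add: Pi1_incl_def)
    note ax = al[OF xy(1)] and ay = al[OF xy(2)]
    have Fi: "Comp D (On_arr F ?p) (On_arr F a) = Ide D (On_obj F y)"
      using F(3,4) p a i xy o by metis
    have Gi: "Comp D (On_arr G a) (On_arr G ?p) = Ide D (On_obj G x)"
      using G(3,4) p a i xy o by metis
    have "Comp D (\<alpha> x) (On_arr F a) =
        Comp D (Comp D (Comp D (On_arr G a) (On_arr G ?p)) (\<alpha> x)) (On_arr F a)"
      using Gi D.Comp_Ide_left[OF ax] by simp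
    also have "\<dots> = Comp D (Comp D (On_arr G a) (Comp D (\<alpha> y) (On_arr F ?p))) (On_arr F a)"
      using D.Comp_assoc[OF ax G(2)[OF p] G(2)[OF a]] nf by simp
    also have "\<dots> = Comp D (On_arr G a) (Comp D (Comp D (\<alpha> y) (On_arr F ?p)) (On_arr F a))"
      using D.Comp_assoc[OF F(2)[OF a] D.Comp_in[OF F(2)[OF p] ay] G(2)[OF a]] by simp
    also have "\<dots> = Comp D (On_arr G a) (\<alpha> y)"
      using D.Comp_assoc[OF F(2)[OF a] F(2)[OF p] ay] Fi D.Comp_Ide_right[OF ay] by simp
    finally show "Comp D (\<alpha> x) (On_arr F a) = Comp D (On_arr G a) (\<alpha> y)" .
  qed
  have ext: "\<alpha> \<in> extensional (Obj C)" using assms(5) by (simp add: nat_trans_def)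
  have incl: "On_obj (Pi1_incl C) x = x" if "x \<in> Obj C" for x
    using that by (simp add: Pi1_incl_def)
  show ?thesis
  proof (rule ex1I[of _ \<alpha>])
    show "nat_trans (Pi1 C) D F G \<alpha> \<and> (\<forall>x \<in> Obj C. \<alpha> (On_obj (Pi1_incl C) x) = \<alpha> x)"
      using ext al nat incl by (simp add: nat_trans_def o)
    show "\<beta> = \<alpha>" if "nat_trans (Pi1 C) D F G \<beta> \<and>
        (\<forall>x \<in> Obj C. \<beta> (On_obj (Pi1_incl C) x) = \<alpha> x)" for \<beta>
      using that ext incl by (intro extensionalityI[of _ "Obj C"]) (auto simp: nat_trans_def o)
  qed
qed


lemma chain_face_eq:
  assumes "length xs = n + 2" "length fs = n + 1" "i \<le> n + 1"
  shows "chain_face C (Suc n) i (xs, fs) =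
    (map (\<lambda>k. if k < i then xs ! k else xs ! (k + 1)) [0..<n + 1],
     map (\<lambda>k. if k + 1 < i then fs ! k
       else if k + 1 = i then Comp C (fs ! (k + 1)) (fs ! k) else fs ! (k + 1)) [0..<n])"
proof -
  have "take i xs @ drop (i + 1) xs = map (\<lambda>k. if k < i then xs ! k else xs ! (k + 1)) [0..<n + 1]"
    using assms by (intro nth_equalityI) (auto simp: nth_append min_def simp del: upt_Suc)
  moreover have "tl fs = map (\<lambda>k. fs ! (k + 1)) [0..<n]"
    using assms by (intro nth_equalityI) (auto simp: nth_tl)
  moreover have "butlast fs = map (\<lambda>k. fs ! k) [0..<n]"
    using assms by (intro nth_equalityI) (auto simp: nth_butlast)
  moreover have "take (i - 1) fs @ [Comp C (fs ! i) (fs ! (i - 1))] @ drop (i + 1) fs =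
      map (\<lambda>k. if k + 1 < i then fs ! k
       else if k + 1 = i then Comp C (fs ! (k + 1)) (fs ! k) else fs ! (k + 1)) [0..<n]"
    if "0 < i" "i \<le> n"
    using assms that by (intro nth_equalityI) (auto simp: nth_append nth_Cons' min_def)
  ultimately show ?thesis
    using assms(3) by (auto simp: chain_face_def simp del: upt_Suc)
qed

lemma chain_degen_eq:
  assumes "length xs = n + 1" "length fs = n" "i \<le> n"
  shows "chain_degen C i (xs, fs) =
    (map (\<lambda>k. if k \<le> i then xs ! k else xs ! (k - 1)) [0..<n + 2],
     map (\<lambda>k. if k < i then fs ! k else if k = i then Ide C (xs ! i) else fs ! (k - 1)) [0..<n + 1])"
proof -
  have "take (i + 1) xs @ drop i xs =
      map (\<lambda>k. if k \<le> i then xs ! k else xs ! (k - 1)) [0..<n + 2]"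
    using assms by (intro nth_equalityI) (auto simp: nth_append min_def simp del: upt_Suc)
  moreover have "take i fs @ [Ide C (xs ! i)] @ drop i fs =
      map (\<lambda>k. if k < i then fs ! k else if k = i then Ide C (xs ! i) else fs ! (k - 1)) [0..<n + 1]"
    using assms
    by (intro nth_equalityI) (auto simp: nth_append nth_Cons' min_def simp del: upt_Suc)
  ultimately show ?thesis by (simp add: chain_degen_def)
qed

lemma chain_face_map:
  assumes "i \<le> n + 1"
  shows "chain_face C (Suc n) i (map x [0..<n + 2], map f [0..<n + 1]) =
    (map (\<lambda>k. if k < i then x k else x (k + 1)) [0..<n + 1],
     map (\<lambda>k. if k + 1 < i then f k
       else if k + 1 = i then Comp C (f (k + 1)) (f k) else f (k + 1)) [0..<n])"
proof -
  have nth: "map x [0..<n + 2] ! k = x k" "map f [0..<n + 1] ! k = f k"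
    if "k < n + 1" for k using that by (simp_all del: upt_Suc)
  have nth': "map x [0..<n + 2] ! (k + 1) = x (k + 1)" if "k < n + 1" for k
    using that by (simp del: upt_Suc)
  have nth'': "map f [0..<n + 1] ! (k + 1) = f (k + 1)" if "k < n" for k
    using that by (simp del: upt_Suc)
  have "chain_face C (Suc n) i (map x [0..<n + 2], map f [0..<n + 1]) =
    (map (\<lambda>k. if k < i then map x [0..<n + 2] ! k else map x [0..<n + 2] ! (k + 1)) [0..<n + 1],
     map (\<lambda>k. if k + 1 < i then map f [0..<n + 1] ! k
       else if k + 1 = i then Comp C (map f [0..<n + 1] ! (k + 1)) (map f [0..<n + 1] ! k)
       else map f [0..<n + 1] ! (k + 1)) [0..<n])"
    using assms by (intro chain_face_eq) simp_all
  also have "\<dots> = (map (\<lambda>k. if k < i then x k else x (k + 1)) [0..<n + 1],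
     map (\<lambda>k. if k + 1 < i then f k
       else if k + 1 = i then Comp C (f (k + 1)) (f k) else f (k + 1)) [0..<n])"
    by (intro arg_cong2[where f = Pair] map_cong refl) (simp_all only: set_upt atLeastLessThan_iff nth nth' nth'' trans_less_add1)
  finally show ?thesis .
qed

lemma chain_degen_map:
  assumes "i \<le> n"
  shows "chain_degen C i (map x [0..<n + 1], map f [0..<n]) =
    (map (\<lambda>k. if k \<le> i then x k else x (k - 1)) [0..<n + 2],
     map (\<lambda>k. if k < i then f k else if k = i then Ide C (x i) else f (k - 1)) [0..<n + 1])"
proof -
  have nth: "map x [0..<n + 1] ! k = x k" if "k < n + 1" for k
    using that by (simp del: upt_Suc)
  have nth': "map f [0..<n] ! k = f k" if "k < n" for k
    using that by simp
  have "chain_degen C i (map x [0..<n + 1], map f [0..<n]) =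
    (map (\<lambda>k. if k \<le> i then map x [0..<n + 1] ! k else map x [0..<n + 1] ! (k - 1)) [0..<n + 2],
     map (\<lambda>k. if k < i then map f [0..<n] ! k
       else if k = i then Ide C (map x [0..<n + 1] ! i) else map f [0..<n] ! (k - 1)) [0..<n + 1])"
    using assms by (intro chain_degen_eq) simp_all
  also have "\<dots> = (map (\<lambda>k. if k \<le> i then x k else x (k - 1)) [0..<n + 2],
     map (\<lambda>k. if k < i then f k else if k = i then Ide C (x i) else f (k - 1)) [0..<n + 1])"
    using assms by (intro arg_cong2[where f = Pair] map_cong refl) (auto simp: nth nth' simp del: upt_Suc)
  finally show ?thesis .
qed

lemmas chain_map_simps = chain_face_map[unfolded add_2_eq_Suc' Suc_eq_plus1[symmetric]]
  chain_degen_map[unfolded add_2_eq_Suc' Suc_eq_plus1[symmetric]]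

lemma chains_iff:
  "(xs, fs) \<in> chains C n \<longleftrightarrow> length xs = n + 1 \<and> length fs = n \<and> (\<forall>k \<le> n. xs ! k \<in> Obj C) \<and>
     (\<forall>k < n. fs ! k \<in> Hom C (xs ! k) (xs ! (k + 1)))"
proof -
  have "set xs \<subseteq> Obj C \<longleftrightarrow> (\<forall>k \<le> n. xs ! k \<in> Obj C)" if "length xs = n + 1"
    using that by (simp add: set_conv_nth subset_iff less_Suc_eq_le) blast
  then show ?thesis by (auto simp: chains_def)
qed

context category
begin

lemma chain_face_in:
  assumes "a \<in> chains C (Suc n)" "i \<le> Suc n"
  shows "chain_face C (Suc n) i a \<in> chains C n"
proof -
  obtain xs fs where a: "a = (xs, fs)" by (cases a)
  have c: "length xs = n + 2" "length fs = n + 1" "i \<le> n + 1" "\<And>k. k \<le> n + 1 \<Longrightarrow> xs ! k \<in> Obj C"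
    "\<And>k. k \<le> n \<Longrightarrow> fs ! k \<in> Hom C (xs ! k) (xs ! Suc k)"
    using assms by (auto simp: a chains_iff)
  have "Comp C (fs ! Suc k) (fs ! k) \<in> Hom C (xs ! k) (xs ! Suc (Suc k))" if "k < n" for k
    using c(5)[of k] c(5)[of "Suc k"] that Comp_in by simp
  then show ?thesis
    unfolding a chain_face_eq[OF c(1-3)] chains_iff
    using c(4,5) by (auto simp del: upt_Suc)
qed

lemma chain_degen_in:
  assumes "a \<in> chains C n" "i \<le> n"
  shows "chain_degen C i a \<in> chains C (Suc n)"
proof -
  obtain xs fs where a: "a = (xs, fs)" by (cases a)
  have c: "length xs = n + 1" "length fs = n" "i \<le> n" "\<And>k. k \<le> n \<Longrightarrow> xs ! k \<in> Obj C"
    "\<And>k. k < n \<Longrightarrow> fs ! k \<in> Hom C (xs ! k) (xs ! Suc k)"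
    using assms by (auto simp: a chains_iff)
  have "fs ! (k - 1) \<in> Hom C (xs ! (k - 1)) (xs ! k)" if "i < k" "k \<le> n" for k
    using c(5)[of "k - 1"] that by simp
  then show ?thesis
    unfolding a chain_degen_eq[OF c(1-3)] chains_iff
    using c(3,4,5) Ide_in by (auto simp del: upt_Suc simp: less_Suc_eq_le)
qed

lemma nerve_simplexE:
  assumes "a \<in> Simplices (nerve C) n"
  obtains x f where "a = (map x [0..<n + 1], map f [0..<n])"
    "\<And>k. k < n \<Longrightarrow> f k \<in> Hom C (x k) (x (k + 1))"
proof -
  obtain xs fs where a: "a = (xs, fs)" by (cases a)
  have "xs = map ((!) xs) [0..<n + 1]" "fs = map ((!) fs) [0..<n]"
    "\<And>k. k < n \<Longrightarrow> fs ! k \<in> Hom C (xs ! k) (xs ! (k + 1))"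
    using assms map_nth[of xs] map_nth[of fs] by (auto simp: a nerve_def chains_iff simp del: upt_Suc)
  then show ?thesis using that a by blast
qed

theorem simplicial_nerve: "simplicial_set (nerve C)"
proof
  fix a n i assume "a \<in> Simplices (nerve C) (Suc n)" "i \<le> Suc n"
  then show "Face (nerve C) (Suc n) i a \<in> Simplices (nerve C) n"
    by (simp add: nerve_def chain_face_in)
next
  fix a n i assume "a \<in> Simplices (nerve C) n" "i \<le> n"
  then show "Degen (nerve C) n i a \<in> Simplices (nerve C) (Suc n)"
    by (simp add: nerve_def chain_degen_in)
next
  fix a n i j
  assume "a \<in> Simplices (nerve C) (Suc (Suc n))" and ij: "i < j" "j \<le> Suc (Suc n)"
  then obtain x f where a: "a = (map x [0..<Suc (Suc (Suc n))], map f [0..<Suc (Suc n)])"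
    and f: "\<And>k. k < Suc (Suc n) \<Longrightarrow> f k \<in> Hom C (x k) (x (Suc k))"
    by (elim nerve_simplexE) (auto simp del: upt_Suc)
  have as: "Comp C (f (Suc (Suc k))) (Comp C (f (Suc k)) (f k)) =
      Comp C (Comp C (f (Suc (Suc k))) (f (Suc k))) (f k)" if "k < n" for k
    using Comp_assoc[OF f[of k] f[of "Suc k"]] f[of "Suc (Suc k)"] that by simp
  obtain m where j: "j = Suc m" "i \<le> m" "m \<le> Suc n" using ij by (cases j) auto
  have "i \<le> Suc (Suc n)" "i \<le> Suc n" using j by auto
  then have "chain_face C (Suc n) i (chain_face C (Suc (Suc n)) (Suc m) a) =
      chain_face C (Suc n) m (chain_face C (Suc (Suc n)) i a)"
    unfolding a using j
    by (simp add: chain_map_simps split del: if_split del: upt_Suc)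
      (auto simp: as)
  then show "Face (nerve C) (Suc n) i (Face (nerve C) (Suc (Suc n)) j a) =
      Face (nerve C) (Suc n) (j - 1) (Face (nerve C) (Suc (Suc n)) i a)"
    by (simp add: nerve_def j)
next
  fix a n i j assume "a \<in> Simplices (nerve C) n" and ij: "i \<le> j" "j \<le> n"
  then obtain x f where a: "a = (map x [0..<Suc n], map f [0..<n])"
    by (elim nerve_simplexE) (auto simp del: upt_Suc)
  have "chain_degen C i (chain_degen C j a) = chain_degen C (Suc j) (chain_degen C i a)"
    unfolding a using ij
    by (simp add: chain_map_simps split del: if_split del: upt_Suc)
      (auto simp: diff_Suc split: nat.split)
  then show "Degen (nerve C) (Suc n) i (Degen (nerve C) n j a) =
      Degen (nerve C) (Suc n) (Suc j) (Degen (nerve C) n i a)"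
    by (simp add: nerve_def)
next
  fix a n i j assume "a \<in> Simplices (nerve C) (Suc n)" and ij: "i < j" "j \<le> Suc n"
  then obtain x f where a: "a = (map x [0..<Suc (Suc n)], map f [0..<Suc n])"
    and f: "\<And>k. k < Suc n \<Longrightarrow> f k \<in> Hom C (x k) (x (Suc k))"
    by (elim nerve_simplexE) (auto simp del: upt_Suc)
  obtain m where j: "j = Suc m" "i \<le> m" "m \<le> n" using ij by (cases j) auto
  have "chain_face C (Suc (Suc n)) i (chain_degen C (Suc m) a) =
      chain_degen C m (chain_face C (Suc n) i a)"
    unfolding a using j Comp_Ide_left[OF f]
    by (simp add: chain_map_simps split del: if_split del: upt_Suc)
      (auto simp: diff_Suc split: nat.split)
  then show "Face (nerve C) (Suc (Suc n)) i (Degen (nerve C) (Suc n) j a) =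
      Degen (nerve C) n (j - 1) (Face (nerve C) (Suc n) i a)"
    by (simp add: nerve_def j)
next
  fix a n i j assume "a \<in> Simplices (nerve C) n" and ij: "j \<le> n" "i = j \<or> i = Suc j"
  then obtain x f where a: "a = (map x [0..<Suc n], map f [0..<n])"
    and f: "\<And>k. k < n \<Longrightarrow> f k \<in> Hom C (x k) (x (Suc k))"
    by (elim nerve_simplexE) (auto simp del: upt_Suc)
  have "i \<le> Suc n" using ij by auto
  then have "chain_face C (Suc n) i (chain_degen C j a) = a"
    unfolding a using ij Comp_Ide_left[OF f] Comp_Ide_right[OF f]
    by (simp add: chain_map_simps split del: if_split del: upt_Suc) auto
  then show "Face (nerve C) (Suc n) i (Degen (nerve C) n j a) = a"
    by (simp add: nerve_def)
next
  fix a n i j assume "a \<in> Simplices (nerve C) (Suc n)" and ij: "Suc j < i" "i \<le> Suc (Suc n)"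
  then obtain x f where a: "a = (map x [0..<Suc (Suc n)], map f [0..<Suc n])"
    by (elim nerve_simplexE) (auto simp del: upt_Suc)
  obtain m where i: "i = Suc m" "j < m" "m \<le> Suc n" "j \<le> n" "j \<le> Suc n" using ij by (cases i) auto
  then have "chain_face C (Suc (Suc n)) (Suc m) (chain_degen C j a) =
      chain_degen C j (chain_face C (Suc n) m a)"
    unfolding a
    by (simp add: chain_map_simps split del: if_split del: upt_Suc)
      (auto simp: diff_Suc split: nat.split)
  then show "Face (nerve C) (Suc (Suc n)) i (Degen (nerve C) (Suc n) j a) =
      Degen (nerve C) n j (Face (nerve C) (Suc n) (i - 1) a)"
    by (simp add: nerve_def i)
qed

end

end

theory Submission
  imports Defs
begin

text \<open>Let \<open>t\<close> be a duplicial structure on the nerve. Since \<open>d\<^sub>0 t = d\<^sub>n\<close> on chains of length \<open>n\<close>,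
the operator \<open>t\<close> drops the last object and keeps everything before it, so that only a new first
object and a new first arrow remain to be chosen. The remaining face identities reduce this choice
to dimensions \<open>0\<close> and \<open>1\<close>: the new object is \<open>T x\<^sub>n\<close> and the new arrow is \<open>\<tau>\<close> of the composite of
the whole chain, where \<open>T\<close> is \<open>t\<close> on objects and \<open>\<tau> f : T y \<rightarrow> x\<close> is the arrow underlying \<open>t f\<close>,
for \<open>f : x \<rightarrow> y\<close>. All the identities together then say no more than
\<open>f \<circ> \<tau> (g \<circ> f) = \<tau> g\<close> and \<open>\<tau> (\<tau> (Ide x)) = Ide (T x)\<close>; this is the locale \<open>rotation\<close>.

Given such a pair, put \<open>\<epsilon> x = \<tau> (Ide x) : T x \<rightarrow> x\<close>. For \<open>h : w \<rightarrow> T y\<close> the two identities exhibit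
\<open>\<tau> (\<epsilon> y \<circ> h)\<close> as a right inverse of \<open>h\<close>. If \<open>w = T x\<close>, this right inverse has a right inverse
itself, so it is a two-sided inverse. Hence the full subcategory on the objects \<open>T x\<close> is a groupoid,
and an arrow \<open>T x \<rightarrow> T y\<close> is determined by its composite with \<open>\<epsilon> y\<close>. The arrow \<open>\<tau> (\<tau> f)\<close> satisfies
\<open>\<epsilon> y \<circ> \<tau> (\<tau> f) = f \<circ> \<epsilon> x\<close>, so by uniqueness \<open>f \<mapsto> \<tau> (\<tau> f)\<close> is a functor into this groupoid. It extends
along \<open>p\<close> to a functor \<open>l\<close> on the free groupoid, which is left adjoint to \<open>p\<close>: the counit is \<open>\<epsilon>\<close> and
the unit is the inverse of \<open>p \<epsilon>\<close>.

Conversely, in a groupoid \<open>p f\<close> is invertible, so that an adjunction yields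
\<open>\<tau> f = \<epsilon> x \<circ> l ((p f)\<^sup>-\<^sup>1) : l y \<rightarrow> x\<close>. One of the triangle identities says that the unit is inverse to
\<open>p \<epsilon>\<close>, and naturality of the unit then recovers \<open>l\<close> on arrows. An adjunction is therefore
determined by \<open>l\<close> on objects and by \<open>\<epsilon>\<close>, both of which can be read off from \<open>t\<close> on identities
(\<open>adjunction_unique\<close>). This makes the passage from adjunctions to duplicial structures injective,
and the construction above makes it surjective (\<open>adjoint_duplicial_surj\<close>).\<close>

section \<open>Rotating chains\<close>

text \<open>Indexing objects and arrows by functions turns faces and degeneracies into pointwise
  operations; only the values \<open>x 0, \<dots>, x n\<close> and \<open>f 0, \<dots>, f (n - 1)\<close> enter.\<close>

definition chain_of :: "nat \<Rightarrow> (nat \<Rightarrow> 'o) \<Rightarrow> (nat \<Rightarrow> 'm) \<Rightarrow> ('o, 'm) chain" where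
  "chain_of n x f = (map x [0..<Suc n], map f [0..<n])"

lemma chain_of_eq_iff:
  "chain_of n x f = chain_of n y g \<longleftrightarrow> (\<forall>k \<le> n. x k = y k) \<and> (\<forall>k < n. f k = g k)"
  by (auto simp: chain_of_def simp del: upt_Suc)

lemma chain_of_nth: "length xs = Suc n \<Longrightarrow> length fs = n \<Longrightarrow> chain_of n ((!) xs) ((!) fs) = (xs, fs)"
  using map_nth[of xs] map_nth[of fs] by (simp add: chain_of_def del: upt_Suc)

definition path :: "('o, 'm) cat \<Rightarrow> nat \<Rightarrow> (nat \<Rightarrow> 'o) \<Rightarrow> (nat \<Rightarrow> 'm) \<Rightarrow> bool" where
  "path C n x f \<longleftrightarrow> (\<forall>k \<le> n. x k \<in> Obj C) \<and> (\<forall>k < n. f k \<in> Hom C (x k) (x (Suc k)))"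

lemma chain_of_in_chains: "chain_of n x f \<in> chains C n \<longleftrightarrow> path C n x f"
  by (auto simp: chain_of_def chains_iff path_def simp del: upt_Suc)

lemma chainE:
  assumes "a \<in> chains C n"
  obtains x f where "a = chain_of n x f" "path C n x f"
proof -
  obtain xs fs where a: "a = (xs, fs)" by (cases a)
  then have "a = chain_of n ((!) xs) ((!) fs)"
    using assms by (simp add: chains_iff chain_of_nth)
  then show ?thesis using that assms chain_of_in_chains by metis
qed

fun composite :: "('o, 'm) cat \<Rightarrow> (nat \<Rightarrow> 'o) \<Rightarrow> (nat \<Rightarrow> 'm) \<Rightarrow> nat \<Rightarrow> 'm" where
  "composite C x f 0 = Ide C (x 0)"
| "composite C x f (Suc n) = Comp C (f n) (composite C x f n)"

lemma composite_cong:
  "x 0 = y 0 \<Longrightarrow> (\<And>k. k < n \<Longrightarrow> f k = g k) \<Longrightarrow> composite C x f n = composite C y g n"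
  by (induction n) auto

definition omit :: "nat \<Rightarrow> (nat \<Rightarrow> 'o) \<Rightarrow> nat \<Rightarrow> 'o" where
  "omit i x k = (if k < i then x k else x (Suc k))"

definition omit_arr :: "('o, 'm) cat \<Rightarrow> nat \<Rightarrow> (nat \<Rightarrow> 'm) \<Rightarrow> nat \<Rightarrow> 'm" where
  "omit_arr C i f k =
    (if Suc k < i then f k else if Suc k = i then Comp C (f (Suc k)) (f k) else f (Suc k))"

definition insert_obj :: "nat \<Rightarrow> (nat \<Rightarrow> 'o) \<Rightarrow> nat \<Rightarrow> 'o" where
  "insert_obj i x k = (if k \<le> i then x k else x (k - 1))"

definition insert_ide :: "('o, 'm) cat \<Rightarrow> nat \<Rightarrow> (nat \<Rightarrow> 'o) \<Rightarrow> (nat \<Rightarrow> 'm) \<Rightarrow> nat \<Rightarrow> 'm" where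
  "insert_ide C i x f k =
    (if k < i then f k else if k = i then Ide C (x i) else f (k - 1))"

lemma chain_face_of:
  "i \<le> Suc n \<Longrightarrow>
    chain_face C (Suc n) i (chain_of (Suc n) x f) = chain_of n (omit i x) (omit_arr C i f)"
  using chain_face_map[of i n C x f]
  unfolding chain_of_def omit_def[abs_def] omit_arr_def[abs_def]
  by (simp del: upt_Suc)

lemma chain_degen_of:
  "i \<le> n \<Longrightarrow>
    chain_degen C i (chain_of n x f) = chain_of (Suc n) (insert_obj i x) (insert_ide C i x f)"
  using chain_degen_map[of i n C x f]
  unfolding chain_of_def insert_obj_def[abs_def] insert_ide_def[abs_def]
  by (simp del: upt_Suc)

context category
begin

lemma path_omit: "path C (Suc n) x f \<Longrightarrow> i \<le> Suc n \<Longrightarrow> path C n (omit i x) (omit_arr C i f)"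
  using chain_face_in chain_face_of chain_of_in_chains by metis

lemma path_insert: "path C n x f \<Longrightarrow> i \<le> n \<Longrightarrow> path C (Suc n) (insert_obj i x) (insert_ide C i x f)"
  using chain_degen_in chain_degen_of chain_of_in_chains by metis

lemma composite_in: "path C n x f \<Longrightarrow> composite C x f n \<in> Hom C (x 0) (x n)"
proof (induction n)
  case 0
  then show ?case by (simp add: path_def Ide_in)
next
  case (Suc n)
  have "composite C x f n \<in> Hom C (x 0) (x n)" "f n \<in> Hom C (x n) (x (Suc n))"
    using Suc by (auto simp: path_def)
  then show ?case using Comp_in by simp
qed

lemma path_SucD: "path C (Suc n) x f \<Longrightarrow> path C n x f \<and> f n \<in> Hom C (x n) (x (Suc n))"
  by (auto simp: path_def)

lemma composite_first:
  "path C (Suc n) x f \<Longrightarrow>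
    composite C x f (Suc n) = Comp C (composite C (\<lambda>k. x (Suc k)) (\<lambda>k. f (Suc k)) n) (f 0)"
proof (induction n)
  case 0
  then have "f 0 \<in> Hom C (x 0) (x (Suc 0))" by (auto simp: path_def)
  then show ?case by (simp add: Comp_Ide_left Comp_Ide_right)
next
  case (Suc n)
  have "path C n (\<lambda>k. x (Suc k)) (\<lambda>k. f (Suc k))" "f 0 \<in> Hom C (x 0) (x (Suc 0))"
    "f (Suc n) \<in> Hom C (x (Suc n)) (x (Suc (Suc n)))"
    using Suc.prems by (auto simp: path_def)
  from Comp_assoc[OF this(2) composite_in[OF this(1)] this(3)]
  show ?case using Suc.IH path_SucD[OF Suc.prems] by simp
qed

text \<open>Omitting an inner object or inserting an identity leaves the composite of a chain unchanged.
  This is why a rotation whose first arrow is a function of the composite alone is compatible with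
  inner faces and with degeneracies.\<close>

lemma composite_omit:
  "path C (Suc n) x f \<Longrightarrow> 0 < i \<Longrightarrow> i \<le> n \<Longrightarrow>
    composite C (omit i x) (omit_arr C i f) n = composite C x f (Suc n)"
proof (induction n)
  case (Suc n)
  note p = path_SucD[OF Suc.prems(1)] path_SucD[OF conjunct1[OF path_SucD[OF Suc.prems(1)]]]
  show ?case
  proof (cases "i = Suc n")
    case True
    have "composite C (omit i x) (omit_arr C i f) n = composite C x f n"
      using True by (intro composite_cong) (auto simp: omit_def omit_arr_def)
    then show ?thesis
      using True p Comp_assoc[OF composite_in, of n x f "f n" "x (Suc n)" "f (Suc n)" "x (Suc (Suc n))"]
      by (simp add: omit_arr_def[of C _ f n])
  next
    case False
    then show ?thesis using Suc p by (simp add: omit_arr_def)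
  qed
qed simp

lemma composite_insert:
  "path C n x f \<Longrightarrow> i \<le> n \<Longrightarrow>
    composite C (insert_obj i x) (insert_ide C i x f) (Suc n) = composite C x f n"
proof (induction n)
  case 0
  then show ?case using Comp_Ide_left[OF Ide_in] by (simp add: insert_obj_def insert_ide_def path_def)
next
  case (Suc n)
  show ?case
  proof (cases "i = Suc n")
    case True
    have "composite C (insert_obj i x) (insert_ide C i x f) (Suc n) = composite C x f (Suc n)"
      using True by (intro composite_cong) (auto simp: insert_obj_def insert_ide_def)
    then show ?thesis
      using True Comp_Ide_left[OF composite_in[OF Suc.prems(1)]]
      by (simp add: insert_ide_def[of C _ x f "Suc n"])
  next
    case False
    then show ?thesis
      using Suc path_SucD[OF Suc.prems(1)] by (simp add: insert_ide_def)
  qed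
qed

end

text \<open>Here \<open>case_nat a x\<close> is the sequence \<open>a, x 0, x 1, \<dots>\<close>, which \<open>chain_of n\<close> cuts off before the last
  object of the given chain. For \<open>n = 0\<close> the cut also removes the arrow in front.\<close>

definition rotate_chain :: "('o, 'm) cat \<Rightarrow> ('o \<Rightarrow> 'o) \<Rightarrow> ('m \<Rightarrow> 'm) \<Rightarrow> nat \<Rightarrow>
    ('o, 'm) chain \<Rightarrow> ('o, 'm) chain" where
  "rotate_chain C T \<tau> n = (\<lambda>(xs, fs) \<in> chains C n.
     chain_of n (case_nat (T (xs ! n)) ((!) xs))
       (case_nat (\<tau> (composite C ((!) xs) ((!) fs) n)) ((!) fs)))"

lemma rotate_chain_of:
  assumes "path C n x f"
  shows "rotate_chain C T \<tau> n (chain_of n x f) =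
    chain_of n (case_nat (T (x n)) x) (case_nat (\<tau> (composite C x f n)) f)"
proof -
  obtain xs fs where c: "chain_of n x f = (xs, fs)" by (cases "chain_of n x f")
  then have nth: "xs ! k = x k" if "k \<le> n" for k
    using that by (auto simp: chain_of_def simp del: upt_Suc)
  have nth': "fs ! k = f k" if "k < n" for k
    using c that by (auto simp: chain_of_def)
  have "composite C ((!) xs) ((!) fs) n = composite C x f n"
    by (intro composite_cong) (auto simp: nth nth')
  then show ?thesis
    using assms unfolding chain_of_in_chains[symmetric] 
    by (auto simp: rotate_chain_def c chain_of_eq_iff nth nth' split: nat.split)
qed

lemma rotate_chain_cong:
  assumes "category C" "\<And>x. x \<in> Obj C \<Longrightarrow> T x = T' x" "\<And>f. f \<in> Arr C \<Longrightarrow> \<tau> f = \<tau>' f"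
  shows "rotate_chain C T \<tau> n = rotate_chain C T' \<tau>' n"
proof (rule ext)
  interpret category C by fact
  fix a
  show "rotate_chain C T \<tau> n a = rotate_chain C T' \<tau>' n a"
  proof (cases "a \<in> chains C n")
    case True
    then obtain x f where a: "a = chain_of n x f" "path C n x f" by (rule chainE)
    then have "x n \<in> Obj C" "composite C x f n \<in> Arr C"
      using composite_in[of n x f] Hom_ObjD by (auto simp: path_def)
    then show ?thesis using assms a by (simp add: rotate_chain_of)
  qed (simp add: rotate_chain_def)
qed

text \<open>The values of a duplicial structure in dimensions \<open>0\<close> and \<open>1\<close>, with the two identities that
  carry all the others: \<open>rot_cancel\<close> is \<open>d\<^sub>1 t\<^sub>2 = t\<^sub>1 d\<^sub>0\<close> on the chain \<open>f, g\<close>, and \<open>rot_rot_Ide\<close> is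
  \<open>s\<^sub>0 t\<^sub>0 = t\<^sub>1\<^sup>2 s\<^sub>0\<close>.\<close>

locale rotation = category C for C :: "('o, 'm) cat" +
  fixes T :: "'o \<Rightarrow> 'o" and \<tau> :: "'m \<Rightarrow> 'm"
  assumes rot_in: "f \<in> Hom C x y \<Longrightarrow> \<tau> f \<in> Hom C (T y) x"
    and rot_cancel: "f \<in> Hom C x y \<Longrightarrow> g \<in> Hom C y z \<Longrightarrow> Comp C f (\<tau> (Comp C g f)) = \<tau> g"
    and rot_rot_Ide: "x \<in> Obj C \<Longrightarrow> \<tau> (\<tau> (Ide C x)) = Ide C (T x)"
begin

lemma T_in: "x \<in> Obj C \<Longrightarrow> T x \<in> Obj C"
  using rot_in[OF Ide_in] Hom_ObjD by blast

lemma rot_comp: "f \<in> Hom C x y \<Longrightarrow> Comp C f (\<tau> f) = \<tau> (Ide C y)"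
  using rot_cancel[OF _ Ide_in] Comp_Ide_left Hom_ObjD by metis

lemma path_rotate:
  assumes "path C n x f"
  shows "path C n (case_nat (T (x n)) x) (case_nat (\<tau> (composite C x f n)) f)"
  using assms rot_in[OF composite_in[OF assms]] T_in
  by (auto simp: path_def split: nat.split)

text \<open>The operators \<open>t d\<^sub>i\<close> and \<open>t s\<^sub>i\<close> with an inner face or a degeneracy keep the composite, hence the
  new first arrow. The two identities that need the axioms on \<open>\<tau>\<close> are \<open>d\<^sub>1 t = t d\<^sub>0\<close>, where \<open>d\<^sub>0\<close> removes
  a factor of the composite, as in \<open>rot_cancel\<close>, and
  \<open>s\<^sub>0 t = t\<^sup>2 s\<^sub>n\<close>, where the second rotation acts on a chain with composite \<open>c \<circ> \<tau> c = \<tau> (Ide (x n))\<close>.\<close>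

lemma duplicial_rotate_chain: "duplicial_structure (nerve C) (rotate_chain C T \<tau>)"
  unfolding duplicial_structure_def
proof (intro conjI allI ballI impI)
  fix n
  have "rotate_chain C T \<tau> n a \<in> chains C n" if "a \<in> chains C n" for a
    using that by (rule chainE) (simp add: rotate_chain_of chain_of_in_chains path_rotate)
  then show "rotate_chain C T \<tau> n \<in> Simplices (nerve C) n \<rightarrow>\<^sub>E Simplices (nerve C) n"
    by (auto simp: nerve_def) (simp add: rotate_chain_def)
next
  fix n a i assume "a \<in> Simplices (nerve C) (n + 1)" and i: "1 \<le> i \<and> i \<le> n + 1"
  then obtain x f where a: "a = chain_of (Suc n) x f" "path C (Suc n) x f"
    by (auto simp: nerve_def elim: chainE)
  obtain m where m: "i = Suc m" "m \<le> n" using i by (cases i) auto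
  let ?c = "composite C x f (Suc n)"
  have c: "(if m = 0 then Comp C (f 0) (\<tau> ?c) else \<tau> ?c) =
      \<tau> (composite C (omit m x) (omit_arr C m f) n)" if "0 < n"
  proof (cases "m = 0")
    case True
    have f0: "f 0 \<in> Hom C (x 0) (x (Suc 0))" using a(2) by (simp add: path_def)
    have "path C n (\<lambda>k. x (Suc k)) (\<lambda>k. f (Suc k))" using a(2) by (simp add: path_def)
    from rot_cancel[OF f0 composite_in[OF this]] show ?thesis
      unfolding composite_first[OF a(2)] True
      by (simp add: omit_def[abs_def] omit_arr_def[abs_def])
  qed (use composite_omit[OF a(2)] m in auto)
  show "Face (nerve C) (n + 1) i (rotate_chain C T \<tau> (n + 1) a) =
      rotate_chain C T \<tau> n (Face (nerve C) (n + 1) (i - 1) a)"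
    using m a path_omit[OF a(2), of m] c
    by (auto simp: nerve_def rotate_chain_of chain_face_of chain_of_eq_iff simp del: composite.simps)
       (auto simp: omit_def omit_arr_def split: nat.splits simp del: composite.simps)
next
  fix n a assume "a \<in> Simplices (nerve C) (n + 1)"
  then obtain x f where "a = chain_of (Suc n) x f" "path C (Suc n) x f"
    by (auto simp: nerve_def elim: chainE)
  then show "Face (nerve C) (n + 1) 0 (rotate_chain C T \<tau> (n + 1) a) =
      Face (nerve C) (n + 1) (n + 1) a"
    by (auto simp: nerve_def rotate_chain_of chain_face_of chain_of_eq_iff omit_def omit_arr_def)
next
  fix n a i assume "a \<in> Simplices (nerve C) n" and i: "1 \<le> i \<and> i \<le> n"
  then obtain x f where a: "a = chain_of n x f" "path C n x f"
    by (auto simp: nerve_def elim: chainE)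
  obtain m where m: "i = Suc m" "m < n" using i by (cases i) auto
  have c: "composite C (insert_obj m x) (insert_ide C m x f) (Suc n) = composite C x f n"
    using composite_insert[OF a(2)] m by simp
  show "Degen (nerve C) n i (rotate_chain C T \<tau> n a) =
      rotate_chain C T \<tau> (n + 1) (Degen (nerve C) n (i - 1) a)"
    using m a path_insert[OF a(2), of m] c
    by (auto simp: nerve_def rotate_chain_of chain_degen_of chain_of_eq_iff simp del: composite.simps)
       (auto simp: insert_obj_def insert_ide_def split: nat.splits simp del: composite.simps)
next
  fix n a assume "a \<in> Simplices (nerve C) n"
  then obtain x f where a: "a = chain_of n x f" "path C n x f"
    by (auto simp: nerve_def elim: chainE)
  \<comment> \<open>\<open>(?y, ?g)\<close> is \<open>s\<^sub>n a\<close>, and \<open>(?y', ?g')\<close> is its rotation.\<close>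
  let ?y = "insert_obj n x" and ?g = "insert_ide C n x f"
  let ?y' = "case_nat (T (x n)) ?y" and ?g' = "case_nat (\<tau> (composite C x f n)) ?g"
  have p: "path C (Suc n) ?y ?g" using path_insert[OF a(2)] by simp
  have c: "composite C ?y ?g (Suc n) = composite C x f n"
    using composite_insert[OF a(2)] by simp
  have y: "?y (Suc n) = x n" by (simp add: insert_obj_def)
  have p': "path C (Suc n) ?y' ?g'" using path_rotate[OF p] unfolding c y .
  have "composite C ?y' ?g' (Suc n) = Comp C (composite C x f n) (\<tau> (composite C x f n))"
    unfolding composite_first[OF p']
    by (intro arg_cong2[where f = "Comp C"] composite_cong) (auto simp: insert_obj_def insert_ide_def)
  also have "\<dots> = \<tau> (Ide C (x n))" using rot_comp[OF composite_in[OF a(2)]] .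
  finally have c': "\<tau> (composite C ?y' ?g' (Suc n)) = Ide C (T (x n))"
    using rot_rot_Ide a(2) by (simp add: path_def)
  have "rotate_chain C T \<tau> (Suc n) (rotate_chain C T \<tau> (Suc n) (chain_of (Suc n) ?y ?g)) =
      chain_of (Suc n) (case_nat (T (x n)) ?y') (case_nat (Ide C (T (x n))) ?g')"
    unfolding rotate_chain_of[OF p] c y rotate_chain_of[OF p'] c'
    by (simp add: insert_obj_def)
  also have "\<dots> = chain_degen C 0 (rotate_chain C T \<tau> n a)"
    using a by (auto simp: rotate_chain_of chain_degen_of chain_of_eq_iff)
      (auto simp: insert_obj_def insert_ide_def split: nat.splits)
  finally show "Degen (nerve C) n 0 (rotate_chain C T \<tau> n a) =
      rotate_chain C T \<tau> (n + 1) (rotate_chain C T \<tau> (n + 1) (Degen (nerve C) n n a))"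
    using a by (simp add: nerve_def chain_degen_of)
qed

end

section \<open>Duplicial structures are rotations\<close>

locale duplicial_nerve = category C for C :: "('o, 'm) cat" +
  fixes t :: "nat \<Rightarrow> ('o, 'm) chain \<Rightarrow> ('o, 'm) chain"
  assumes duplicial: "duplicial_structure (nerve C) t"
begin

definition rot_obj :: "'o \<Rightarrow> 'o" where
  "rot_obj x = hd (fst (t 0 ([x], [])))"

definition rot_arr :: "'m \<Rightarrow> 'm" where
  "rot_arr f = hd (snd (t 1 ([Dom C f, Cod C f], [f])))"

lemma t_in: "a \<in> chains C n \<Longrightarrow> t n a \<in> chains C n"
  using duplicial unfolding duplicial_structure_def by (auto simp: nerve_def)

lemma face_t:
  "a \<in> chains C (Suc n) \<Longrightarrow> i \<le> n \<Longrightarrow>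
    chain_face C (Suc n) (Suc i) (t (Suc n) a) = t n (chain_face C (Suc n) i a)"
  using duplicial unfolding duplicial_structure_def by (force simp: nerve_def)

lemma face_0_t:
  "a \<in> chains C (Suc n) \<Longrightarrow>
    chain_face C (Suc n) 0 (t (Suc n) a) = chain_face C (Suc n) (Suc n) a"
  using duplicial unfolding duplicial_structure_def by (force simp: nerve_def)

lemma degen_0_t:
  "a \<in> chains C n \<Longrightarrow> chain_degen C 0 (t n a) = t (Suc n) (t (Suc n) (chain_degen C n a))"
  using duplicial unfolding duplicial_structure_def by (force simp: nerve_def)

text \<open>The face \<open>d\<^sub>0\<close> of \<open>t a\<close> is the last face of \<open>a\<close>, which fixes all but the first object and the
  first arrow. If \<open>a\<close> has at least two arrows, these two survive in the last face of \<open>t a\<close>, which is \<open>t\<close>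
  of an inner face of \<open>a\<close>; that face is shorter and has the same composite and the same last object.\<close>

lemma t_chain_of:
  "path C n x f \<Longrightarrow> t n (chain_of n x f) =
    chain_of n (case_nat (rot_obj (x n)) x) (case_nat (rot_arr (composite C x f n)) f)"
proof (induction n arbitrary: x f)
  case 0
  then have "chain_of 0 x f \<in> chains C 0" by (simp add: chain_of_in_chains)
  from t_in[OF this] obtain y g where y: "t 0 (chain_of 0 x f) = chain_of 0 y g"
    by (rule chainE)
  then have "rot_obj (x 0) = y 0" by (simp add: rot_obj_def chain_of_def)
  then show ?case unfolding y by (simp add: chain_of_eq_iff)
next
  case (Suc n)
  have a: "chain_of (Suc n) x f \<in> chains C (Suc n)" using Suc.prems by (simp add: chain_of_in_chains)
  from t_in[OF this] obtain y g where y: "t (Suc n) (chain_of (Suc n) x f) = chain_of (Suc n) y g"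
    by (rule chainE)
  have "chain_face C (Suc n) 0 (chain_of (Suc n) y g) =
      chain_face C (Suc n) (Suc n) (chain_of (Suc n) x f)"
    using face_0_t[OF a] y by simp
  then have tail: "\<And>k. k \<le> n \<Longrightarrow> y (Suc k) = x k"
    and tail_arr: "\<And>k. k < n \<Longrightarrow> g (Suc k) = f k"
    by (auto simp: chain_face_of chain_of_eq_iff omit_def omit_arr_def)
  have "chain_face C (Suc n) (Suc n) (chain_of (Suc n) y g) =
      t n (chain_of n (omit n x) (omit_arr C n f))"
    using face_t[OF a, of n] y by (simp add: chain_face_of)
  also have "\<dots> = chain_of n (case_nat (rot_obj (omit n x n)) (omit n x))
      (case_nat (rot_arr (composite C (omit n x) (omit_arr C n f) n)) (omit_arr C n f))"
    using path_omit[OF Suc.prems] by (intro Suc.IH) simp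
  finally have last: "chain_of n (omit (Suc n) y) (omit_arr C (Suc n) g) = \<dots>"
    by (simp add: chain_face_of)
  then have y0: "y 0 = rot_obj (x (Suc n))"
    by (auto simp: chain_of_eq_iff omit_def dest: spec[of _ 0])
  have g0: "g 0 = rot_arr (composite C x f (Suc n))"
  proof (cases n)
    case 0
    have f: "f 0 \<in> Hom C (x 0) (x 1)" using Suc.prems by (simp add: path_def)
    then have "([Dom C (f 0), Cod C (f 0)], [f 0]) = chain_of (Suc n) x f"
      using 0 by (simp add: chain_of_def Hom_def)
    then have "rot_arr (f 0) = g 0"
      using y 0 by (simp add: rot_arr_def chain_of_def)
    then show ?thesis using 0 Comp_Ide_right[OF f] by simp
  next
    case (Suc m)
    then have "omit_arr C (Suc n) g 0 = rot_arr (composite C (omit n x) (omit_arr C n f) n)"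
      using last by (simp add: chain_of_eq_iff del: composite.simps)
    then show ?thesis
      using composite_omit[OF Suc.prems, of n] Suc by (simp add: omit_arr_def[of C _ g 0])
  qed
  show ?case
    unfolding y using tail tail_arr y0 g0
    by (auto simp: chain_of_eq_iff split: nat.split simp del: composite.simps)
qed

lemma t_eq_rotate_chain: "t = rotate_chain C rot_obj rot_arr"
proof (intro ext)
  fix n a
  show "t n a = rotate_chain C rot_obj rot_arr n a"
  proof (cases "a \<in> chains C n")
    case True
    then show ?thesis
      by (rule chainE) (simp add: t_chain_of rotate_chain_of)
  next
    case False
    have "t n \<in> extensional (chains C n)"
      using duplicial unfolding duplicial_structure_def by (auto simp: nerve_def PiE_def)
    then have "t n a = undefined" using False by (rule extensional_arb)
    then show ?thesis using False by (simp add: rotate_chain_def)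
  qed
qed

lemma t_arr:
  assumes "f \<in> Hom C x y"
  shows "t 1 ([x, y], [f]) = ([rot_obj y, x], [rot_arr f])"
proof -
  have "path C 1 (case_nat x (\<lambda>_. y)) (\<lambda>_. f)"
    using assms Hom_ObjD by (auto simp: path_def split: nat.split)
  from t_chain_of[OF this] show ?thesis
    using Comp_Ide_right[OF assms] by (simp add: chain_of_def)
qed

lemma rotation: "rotation C rot_obj rot_arr"
proof unfold_locales
  fix f x y assume f: "f \<in> Hom C x y"
  then have "([x, y], [f]) \<in> chains C 1" using Hom_ObjD by (auto simp: chains_def)
  from t_in[OF this] show "rot_arr f \<in> Hom C (rot_obj y) x"
    unfolding t_arr[OF f] by (simp add: chains_def)
next
  fix f g x y z assume f: "f \<in> Hom C x y" and g: "g \<in> Hom C y z"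
  let ?x = "case_nat x (case_nat y (\<lambda>_. z))" and ?f = "case_nat f (\<lambda>_. g)"
  have p: "path C (Suc 1) ?x ?f"
    using f g Hom_ObjD by (auto simp: path_def less_Suc_eq split: nat.split)
  then have "chain_face C (Suc 1) (Suc 0) (t (Suc 1) (chain_of (Suc 1) ?x ?f)) =
      t 1 (chain_face C (Suc 1) 0 (chain_of (Suc 1) ?x ?f))"
    by (intro face_t) (simp_all add: chain_of_in_chains)
  then have "chain_face C (Suc 1) (Suc 0) (chain_of (Suc 1) (case_nat (rot_obj z) ?x)
        (case_nat (rot_arr (Comp C g f)) ?f)) =
      chain_of 1 (case_nat (rot_obj z) (omit 0 ?x)) (case_nat (rot_arr g) (omit_arr C 0 ?f))"
    unfolding t_chain_of[OF p] chain_face_of[OF le0] t_chain_of[OF path_omit[OF p le0]]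
    using f g by (simp add: Comp_Ide_right omit_def[of 0 ?x] omit_arr_def[of C 0 ?f])
  then show "Comp C f (rot_arr (Comp C g f)) = rot_arr g"
    by (simp add: chain_face_of chain_of_eq_iff omit_arr_def)
next
  fix x assume x: "x \<in> Obj C"
  have t0: "t 0 ([x], []) = ([rot_obj x], [])"
    using t_chain_of[of 0 "\<lambda>_. x" undefined] x by (simp add: path_def chain_of_def)
  have "rot_arr (Ide C x) \<in> Hom C (rot_obj x) x"
  proof -
    have "([x, x], [Ide C x]) \<in> chains C 1" using x Ide_in by (auto simp: chains_def)
    from t_in[OF this] show ?thesis unfolding t_arr[OF Ide_in[OF x]] by (simp add: chains_def)
  qed
  moreover have "([x], []) \<in> chains C 0" using x by (simp add: chains_def)
  from degen_0_t[OF this] have "([rot_obj x, rot_obj x], [Ide C (rot_obj x)]) =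
      t 1 (t 1 ([x, x], [Ide C x]))"
    by (simp add: t0 chain_degen_def)
  ultimately show "rot_arr (rot_arr (Ide C x)) = Ide C (rot_obj x)"
    using x by (simp add: t_arr[unfolded One_nat_def] Ide_in)
qed

end

section \<open>From a rotation to a left adjoint\<close>

definition full_subcat :: "('o, 'm) cat \<Rightarrow> 'o set \<Rightarrow> ('o, 'm) cat" where
  "full_subcat C S = C\<lparr>Obj := S, Arr := {f \<in> Arr C. Dom C f \<in> S \<and> Cod C f \<in> S}\<rparr>"

lemma full_subcat_simps [simp]:
  "Obj (full_subcat C S) = S" "Ide (full_subcat C S) = Ide C" "Comp (full_subcat C S) = Comp C"
  by (simp_all add: full_subcat_def)

lemma Hom_full_subcat:
  "f \<in> Hom (full_subcat C S) x y \<longleftrightarrow> x \<in> S \<and> y \<in> S \<and> f \<in> Hom C x y"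
  by (auto simp: Hom_def full_subcat_def)

lemma (in category) category_full_subcat:
  assumes "S \<subseteq> Obj C"
  shows "category (full_subcat C S)"
proof
  show "f \<in> Arr (full_subcat C S) \<Longrightarrow> Dom (full_subcat C S) f \<in> Obj (full_subcat C S)"
    "f \<in> Arr (full_subcat C S) \<Longrightarrow> Cod (full_subcat C S) f \<in> Obj (full_subcat C S)" for f
    by (simp_all add: full_subcat_def)
qed (use assms in \<open>auto simp: Hom_full_subcat Comp_Ide_left Comp_Ide_right
      intro: Ide_in Comp_in Comp_assoc\<close>)

lemma is_functorI:
  assumes "category C" "On_obj F \<in> extensional (Obj C)" "On_arr F \<in> extensional (Arr C)"
    and "\<And>x. x \<in> Obj C \<Longrightarrow> On_obj F x \<in> Obj D"
    and "\<And>f x y. f \<in> Hom C x y \<Longrightarrow> On_arr F f \<in> Hom D (On_obj F x) (On_obj F y)"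
    and "\<And>x. x \<in> Obj C \<Longrightarrow> On_arr F (Ide C x) = Ide D (On_obj F x)"
    and "\<And>f g x y z. f \<in> Hom C x y \<Longrightarrow> g \<in> Hom C y z \<Longrightarrow>
      On_arr F (Comp C g f) = Comp D (On_arr F g) (On_arr F f)"
  shows "is_functor C D F"
proof -
  have "On_arr F f \<in> Arr D" if "f \<in> Arr C" for f
    using assms(5)[of f "Dom C f" "Cod C f"] that by (simp add: Hom_def)
  then show ?thesis using assms by (auto simp: is_functor_def PiE_def)
qed

lemma (in category) is_functor_id: "is_functor C C (id_functor C)"
proof -
  have on: "On_arr (id_functor C) f = f" if "f \<in> Hom C x y" for f x y
    using that by (simp add: id_functor_def Hom_def)
  have ob: "On_obj (id_functor C) x = x" if "x \<in> Obj C" for x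
    using that by (simp add: id_functor_def)
  show ?thesis
  proof (rule is_functorI)
    fix f x y assume f: "f \<in> Hom C x y"
    then show "On_arr (id_functor C) f \<in> Hom C (On_obj (id_functor C) x) (On_obj (id_functor C) y)"
      using Hom_ObjD[OF f] by (simp add: on[OF f] ob)
  next
    fix f g x y z assume "f \<in> Hom C x y" and "g \<in> Hom C y z"
    then show "On_arr (id_functor C) (Comp C g f) =
        Comp C (On_arr (id_functor C) g) (On_arr (id_functor C) f)"
      using on Comp_in by metis
  qed (use category_axioms on[OF Ide_in] ob in \<open>auto simp: id_functor_def\<close>)
qed

lemma is_functor_comp:
  assumes "category C" "is_functor C D F" "is_functor D E G"
  shows "is_functor C E (comp_functor C G F)"
proof -
  interpret category C by fact
  note F = is_functorD[OF assms(2)] and G = is_functorD[OF assms(3)]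
  have on: "On_arr (comp_functor C G F) f = On_arr G (On_arr F f)" if "f \<in> Hom C x y" for f x y
    using Hom_ObjD[OF that] by (simp add: comp_functor_def)
  have ob: "On_obj (comp_functor C G F) x = On_obj G (On_obj F x)" if "x \<in> Obj C" for x
    using that by (simp add: comp_functor_def)
  show ?thesis
  proof (rule is_functorI)
    fix f x y assume f: "f \<in> Hom C x y"
    show "On_arr (comp_functor C G F) f \<in>
        Hom E (On_obj (comp_functor C G F) x) (On_obj (comp_functor C G F) y)"
      using G(2)[OF F(2)[OF f]] Hom_ObjD[OF f] by (simp add: on[OF f] ob)
  next
    fix x assume x: "x \<in> Obj C"
    show "On_arr (comp_functor C G F) (Ide C x) = Ide E (On_obj (comp_functor C G F) x)"
      using x by (simp add: on[OF Ide_in] ob F G)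
  next
    fix f g x y z assume f: "f \<in> Hom C x y" and g: "g \<in> Hom C y z"
    show "On_arr (comp_functor C G F) (Comp C g f) =
        Comp E (On_arr (comp_functor C G F) g) (On_arr (comp_functor C G F) f)"
      by (simp add: on[OF f] on[OF g] on[OF Comp_in[OF f g]] F(4)[OF f g] G(4)[OF F(2)[OF f] F(2)[OF g]])
  qed (use assms F(1) G(1) ob in \<open>auto simp: comp_functor_def\<close>)
qed

text \<open>The pointwise inverse of a natural transformation is natural.\<close>

lemma (in groupoid) inverse_arrow_square:
  assumes "f \<in> Hom C a b" "g \<in> Hom C c d" "u \<in> Hom C a c" "v \<in> Hom C b d"
    and sq: "Comp C v f = Comp C g u"
  shows "Comp C (inverse_arrow C v) g = Comp C f (inverse_arrow C u)"
proof -
  let ?u = "inverse_arrow C u" and ?v = "inverse_arrow C v"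
  note u = inverse_arrow[OF assms(3)] and v = inverse_arrow[OF assms(4)]
  have "Comp C ?v g = Comp C ?v (Comp C g (Comp C u ?u))"
    using u(3) Comp_Ide_right[OF assms(2)] by simp
  also have "\<dots> = Comp C ?v (Comp C (Comp C v f) ?u)"
    using Comp_assoc[OF u(1) assms(3,2)] sq by simp
  also have "\<dots> = Comp C (Comp C ?v (Comp C v f)) ?u"
    using Comp_assoc[OF u(1) Comp_in[OF assms(1,4)] v(1)] .
  also have "\<dots> = Comp C f ?u"
    using Comp_assoc[OF assms(1,4) v(1)] v(2) Comp_Ide_left[OF assms(1)] by simp
  finally show ?thesis .
qed

lemma Obj_Pi1 [simp]: "Obj (Pi1 C) = Obj C"
  by (simp add: Pi1_def)

lemma Pi1_incl_obj [simp]: "x \<in> Obj C \<Longrightarrow> On_obj (Pi1_incl C) x = x"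
  by (simp add: Pi1_incl_def)

lemma (in category) Pi1_incl_in: "f \<in> Hom C x y \<Longrightarrow> On_arr (Pi1_incl C) f \<in> Hom (Pi1 C) x y"
  using is_functorD(2)[OF functor_Pi1_incl] Hom_ObjD by fastforce

context rotation
begin

definition counit :: "'o \<Rightarrow> 'm" where
  "counit x = \<tau> (Ide C x)"

lemma counit_in: "x \<in> Obj C \<Longrightarrow> counit x \<in> Hom C (T x) x"
  unfolding counit_def using rot_in[OF Ide_in] .

text \<open>Take \<open>g = \<epsilon> y\<close> in \<open>f \<circ> \<tau> (g \<circ> f) = \<tau> g\<close> and use \<open>\<tau> (\<epsilon> y) = Ide (T y)\<close>.\<close>

lemma right_inverse:
  assumes y: "y \<in> Obj C" and h: "h \<in> Hom C w (T y)"
  shows "\<tau> (Comp C (counit y) h) \<in> Hom C (T y) w"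
    and "Comp C h (\<tau> (Comp C (counit y) h)) = Ide C (T y)"
  using rot_in[OF Comp_in[OF h counit_in[OF y]]] rot_cancel[OF h counit_in[OF y]] rot_rot_Ide[OF y]
  by (simp_all add: counit_def)

text \<open>The right inverse \<open>k\<close> of \<open>h\<close> ends at \<open>T x\<close>, so it has a right inverse \<open>m\<close> in turn; then
  \<open>h = h \<circ> k \<circ> m = m\<close>.\<close>

lemma left_inverse:
  assumes x: "x \<in> Obj C" and y: "y \<in> Obj C" and h: "h \<in> Hom C (T x) (T y)"
  shows "Comp C (\<tau> (Comp C (counit y) h)) h = Ide C (T x)"
proof -
  let ?k = "\<tau> (Comp C (counit y) h)"
  note k = right_inverse[OF y h]
  note m = right_inverse[OF x k(1)]
  have "h = \<tau> (Comp C (counit x) ?k)"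
    using inverse_unique[OF k(1) h m(1) k(2) m(2)] .
  then show ?thesis using m(2) by simp
qed

text \<open>The inverse \<open>\<tau> (\<epsilon> y \<circ> h)\<close> of \<open>h\<close> depends on \<open>\<epsilon> y \<circ> h\<close> only.\<close>

lemma eq_if_counit_eq:
  assumes x: "x \<in> Obj C" and y: "y \<in> Obj C"
    and h: "h \<in> Hom C (T x) (T y)" "h' \<in> Hom C (T x) (T y)"
    and eq: "Comp C (counit y) h = Comp C (counit y) h'"
  shows "h = h'"
proof -
  note k = right_inverse[OF y h(1)]
  have "Comp C h' (\<tau> (Comp C (counit y) h)) = Ide C (T y)"
    using right_inverse(2)[OF y h(2)] eq by simp
  from inverse_unique[OF k(1) h(2,1) this left_inverse[OF x y h(1)]] show ?thesis by simp
qed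

lemma groupoid_image: "groupoid (full_subcat C (T ` Obj C))"
proof -
  have "T ` Obj C \<subseteq> Obj C" using T_in by auto
  moreover have "\<exists>g \<in> Hom C b a. Comp C g f = Ide C a \<and> Comp C f g = Ide C b"
    if "f \<in> Hom C a b" "a \<in> T ` Obj C" "b \<in> T ` Obj C" for f a b
    using that right_inverse left_inverse by blast
  ultimately show ?thesis
    by (simp add: groupoid_def groupoid_axioms_def category_full_subcat)
      (simp add: Hom_full_subcat Bex_def)
qed

lemma rot_rot_in: "f \<in> Hom C x y \<Longrightarrow> \<tau> (\<tau> f) \<in> Hom C (T x) (T y)"
  using rot_in by blast

text \<open>Both sides equal \<open>f \<circ> \<tau> f \<circ> \<tau> (\<tau> f)\<close>, because \<open>f \<circ> \<tau> f\<close> is, for every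
  arrow \<open>f\<close>, the counit at its codomain.\<close>

lemma counit_natural:
  assumes f: "f \<in> Hom C x y"
  shows "Comp C (counit y) (\<tau> (\<tau> f)) = Comp C f (counit x)"
proof -
  note t = rot_in[OF f]
  have "Comp C (counit y) (\<tau> (\<tau> f)) = Comp C f (Comp C (\<tau> f) (\<tau> (\<tau> f)))"
    using rot_comp[OF f] Comp_assoc[OF rot_in[OF t] t f] by (simp add: counit_def)
  also have "\<dots> = Comp C f (counit x)" using rot_comp[OF t] by (simp add: counit_def)
  finally show ?thesis .
qed

definition rot_functor :: "('o, 'm, 'o, 'm) cat_functor" where
  "rot_functor = \<lparr>On_obj = (\<lambda>x \<in> Obj C. T x), On_arr = (\<lambda>f \<in> Arr C. \<tau> (\<tau> f))\<rparr>"

lemma rot_functor_simps: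
  "x \<in> Obj C \<Longrightarrow> On_obj rot_functor x = T x"
  "f \<in> Hom C x y \<Longrightarrow> On_arr rot_functor f = \<tau> (\<tau> f)"
  by (simp_all add: rot_functor_def Hom_def)

text \<open>Preservation of composites needs no computation with \<open>\<tau>\<close>: by naturality of \<open>\<epsilon>\<close> the two candidates
  have the same composite with \<open>\<epsilon> z\<close>.\<close>

lemma rot_functor: "is_functor C (full_subcat C (T ` Obj C)) rot_functor"
proof (rule is_functorI)
  fix f x y assume f: "f \<in> Hom C x y"
  show "On_arr rot_functor f \<in>
      Hom (full_subcat C (T ` Obj C)) (On_obj rot_functor x) (On_obj rot_functor y)"
    using rot_rot_in[OF f] Hom_ObjD[OF f] by (simp add: rot_functor_simps(2)[OF f] rot_functor_simps(1) Hom_full_subcat)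
next
  fix x assume x: "x \<in> Obj C"
  show "On_arr rot_functor (Ide C x) =
      Ide (full_subcat C (T ` Obj C)) (On_obj rot_functor x)"
    using x rot_rot_Ide by (simp add: rot_functor_simps(2)[OF Ide_in] rot_functor_simps(1))
next
  fix f g x y z assume f: "f \<in> Hom C x y" and g: "g \<in> Hom C y z"
  note xyz = Hom_ObjD[OF f] Hom_ObjD[OF g] and gf = Comp_in[OF f g]
  note f' = rot_rot_in[OF f] and g' = rot_rot_in[OF g] and c = counit_in
  have "Comp C (counit z) (Comp C (\<tau> (\<tau> g)) (\<tau> (\<tau> f))) =
      Comp C (Comp C g (counit y)) (\<tau> (\<tau> f))"
    using Comp_assoc[OF f' g' c] xyz counit_natural[OF g] by simp
  also have "\<dots> = Comp C g (Comp C f (counit x))"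
    using Comp_assoc[OF f' c g] xyz counit_natural[OF f] by simp
  also have "\<dots> = Comp C (counit z) (\<tau> (\<tau> (Comp C g f)))"
    using Comp_assoc[OF c f g] xyz counit_natural[OF gf] by simp
  finally have "\<tau> (\<tau> (Comp C g f)) = Comp C (\<tau> (\<tau> g)) (\<tau> (\<tau> f))"
    using xyz by (intro eq_if_counit_eq[OF _ _ rot_rot_in[OF gf] Comp_in[OF f' g']]) auto
  then show "On_arr rot_functor (Comp C g f) =
      Comp (full_subcat C (T ` Obj C)) (On_arr rot_functor g) (On_arr rot_functor f)"
    by (simp add: rot_functor_simps(2)[OF f] rot_functor_simps(2)[OF g] rot_functor_simps(2)[OF gf])
qed (auto simp: rot_functor_def category_axioms)

text \<open>The universal property of \<open>\<Pi>\<^sub>1\<close> extends the functor \<open>\<tau> \<circ> \<tau>\<close> to \<open>l\<close>, and its 2-dimensional part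
  reduces naturality of the unit to arrows of \<open>C\<close>, where it is the inverse of naturality of \<open>p \<epsilon>\<close>.\<close>

lemma ex_left_adjoint:
  obtains l \<eta> \<epsilon> where "adjunction C (Pi1 C) l (Pi1_incl C) \<eta> \<epsilon>"
    "\<And>x. x \<in> Obj C \<Longrightarrow> On_obj l x = T x"
    "\<And>x. x \<in> Obj C \<Longrightarrow> \<epsilon> x = counit x"
    "\<And>f x y. f \<in> Hom C x y \<Longrightarrow> On_arr l (On_arr (Pi1_incl C) f) = \<tau> (\<tau> f)"
proof -
  let ?G = "full_subcat C (T ` Obj C)" and ?p = "Pi1_incl C"
  interpret P: groupoid "Pi1 C" by (rule groupoid_Pi1)
  obtain l where lG: "is_functor (Pi1 C) ?G l" and lp: "comp_functor C l ?p = rot_functor"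
    using Pi1_universal[OF category_axioms groupoid_image rot_functor] by blast
  note lG' = is_functorD[OF lG]
  have l_obj: "On_obj l x = T x" if "x \<in> Obj C" for x
    using arg_cong[OF lp, of "\<lambda>F. On_obj F x"] that
    by (simp add: comp_functor_def rot_functor_simps)
  have l_arr: "On_arr l (On_arr ?p f) = \<tau> (\<tau> f)" if "f \<in> Hom C x y" for f x y
    using arg_cong[OF lp, of "\<lambda>F. On_arr F f"] Hom_ObjD[OF that]
    by (simp add: comp_functor_def rot_functor_simps(2)[OF that])
  have l: "is_functor (Pi1 C) C l"
  proof (rule is_functorI)
    show "On_obj l \<in> extensional (Obj (Pi1 C))" "On_arr l \<in> extensional (Arr (Pi1 C))"
      using lG by (auto simp: is_functor_def PiE_def)
  qed (use lG' P.category_axioms T_in in \<open>auto simp: Hom_full_subcat l_obj\<close>)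
  note l' = is_functorD[OF l] and p' = is_functorD[OF functor_Pi1_incl]
  define \<epsilon> where "\<epsilon> = (\<lambda>x \<in> Obj C. counit x)"
  define \<eta> where "\<eta> = (\<lambda>x \<in> Obj C. inverse_arrow (Pi1 C) (On_arr ?p (counit x)))"
  have pc: "On_arr ?p (counit x) \<in> Hom (Pi1 C) (T x) x" if "x \<in> Obj C" for x
    using Pi1_incl_in[OF counit_in[OF that]] .
  have \<eta>: "\<eta> x \<in> Hom (Pi1 C) x (T x)" "Comp (Pi1 C) (\<eta> x) (On_arr ?p (counit x)) = Ide (Pi1 C) (T x)"
    "Comp (Pi1 C) (On_arr ?p (counit x)) (\<eta> x) = Ide (Pi1 C) x" if "x \<in> Obj C" for x
    using P.inverse_arrow[OF pc[OF that]] that by (simp_all add: \<eta>_def)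
  have nat_\<epsilon>: "nat_trans C C (comp_functor C l ?p) (id_functor C) \<epsilon>"
    using counit_in counit_natural unfolding nat_trans_def lp
    by (auto simp: \<epsilon>_def id_functor_def rot_functor_simps dest: Hom_ObjD)
  let ?I = "id_functor (Pi1 C)" and ?pl = "comp_functor (Pi1 C) ?p l"
  have nat_C: "nat_trans C (Pi1 C) (comp_functor C ?I ?p) (comp_functor C ?pl ?p) \<eta>"
    unfolding nat_trans_def
  proof (intro conjI allI ballI)
    fix x assume "x \<in> Obj C"
    then show "\<eta> x \<in> Hom (Pi1 C) (On_obj (comp_functor C ?I ?p) x) (On_obj (comp_functor C ?pl ?p) x)"
      using \<eta>(1) T_in by (simp add: comp_functor_def id_functor_def l_obj)
  next
    fix x y f assume f: "f \<in> Hom C x y"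
    note xy = Hom_ObjD[OF f] and r = rot_rot_in[OF f]
    have "Comp (Pi1 C) (On_arr ?p (counit y)) (On_arr ?p (\<tau> (\<tau> f))) =
        Comp (Pi1 C) (On_arr ?p f) (On_arr ?p (counit x))"
      using p'(4)[OF r counit_in] p'(4)[OF counit_in f] counit_natural[OF f] xy by simp
    from P.inverse_arrow_square[OF Pi1_incl_in[OF r] Pi1_incl_in[OF f] pc pc this]
    have "Comp (Pi1 C) (\<eta> y) (On_arr ?p f) = Comp (Pi1 C) (On_arr ?p (\<tau> (\<tau> f))) (\<eta> x)"
      using xy by (simp add: \<eta>_def)
    moreover have "On_arr ?p f \<in> Arr (Pi1 C)" using P.Hom_ObjD[OF Pi1_incl_in[OF f]] by simp
    ultimately show "Comp (Pi1 C) (\<eta> y) (On_arr (comp_functor C ?I ?p) f) =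
        Comp (Pi1 C) (On_arr (comp_functor C ?pl ?p) f) (\<eta> x)"
      using xy by (simp add: comp_functor_def id_functor_def l_arr[OF f])
  qed (simp add: \<eta>_def)
  have nat_\<eta>: "nat_trans (Pi1 C) (Pi1 C) ?I ?pl \<eta>"
  proof -
    obtain \<beta> where \<beta>: "nat_trans (Pi1 C) (Pi1 C) ?I ?pl \<beta>" "\<And>x. x \<in> Obj C \<Longrightarrow> \<beta> x = \<eta> x"
      using Pi1_universal_2cells[OF category_axioms P.category_axioms P.is_functor_id
          is_functor_comp[OF P.category_axioms l functor_Pi1_incl] nat_C] by auto
    have "\<beta> = \<eta>"
      using \<beta> by (intro extensionalityI[of \<beta> "Obj C"]) (auto simp: nat_trans_def \<eta>_def)
    then show ?thesis using \<beta>(1) by simp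
  qed
  have "Comp C (\<epsilon> (On_obj l x)) (On_arr l (\<eta> x)) = Ide C (On_obj l x)" if x: "x \<in> Obj C" for x
  proof -
    \<comment> \<open>Since \<open>\<tau> (\<epsilon> x)\<close> is an identity, \<open>l (p (\<epsilon> x)) = \<tau> (\<tau> (\<epsilon> x))\<close> is the counit at \<open>T x\<close>.\<close>
    have "On_arr l (On_arr ?p (counit x)) = counit (T x)"
      using l_arr[OF counit_in[OF x]] rot_rot_Ide[OF x] by (simp add: counit_def)
    then show ?thesis
      using l'(4)[OF \<eta>(1) pc, OF x x] l'(3)[of x] x \<eta>(3)[OF x] T_in
      by (simp add: \<epsilon>_def l_obj)
  qed
  moreover have "Comp (Pi1 C) (On_arr ?p (\<epsilon> x)) (\<eta> (On_obj ?p x)) = Ide (Pi1 C) (On_obj ?p x)"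
    if "x \<in> Obj C" for x
    using that \<eta>(3) by (simp add: \<epsilon>_def)
  ultimately have "adjunction C (Pi1 C) l ?p \<eta> \<epsilon>"
    using l functor_Pi1_incl nat_\<eta> nat_\<epsilon> by (simp add: adjunction_def)
  then show ?thesis using that l_obj l_arr by (simp add: \<epsilon>_def)
qed

end

section \<open>From a left adjoint to a rotation\<close>

text \<open>The arrow \<open>\<epsilon> x \<circ> l ((p f)\<^sup>-\<^sup>1) : l y \<rightarrow> x\<close> is the transpose of \<open>(p f)\<^sup>-\<^sup>1 : y \<rightarrow> x\<close> under the adjunction.\<close>

definition adjoint_rot :: "('o, 'm) cat \<Rightarrow> ('o, ('o, 'm) zz_arrow, 'o, 'm) cat_functor \<Rightarrow>
    ('o \<Rightarrow> 'm) \<Rightarrow> 'm \<Rightarrow> 'm" where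
  "adjoint_rot C l \<epsilon> f =
     Comp C (\<epsilon> (Dom C f)) (On_arr l (inverse_arrow (Pi1 C) (On_arr (Pi1_incl C) f)))"

locale Pi1_left_adjoint = category C for C :: "('o, 'm) cat" +
  fixes l \<eta> \<epsilon>
  assumes adj: "adjunction C (Pi1 C) l (Pi1_incl C) \<eta> \<epsilon>"
begin

sublocale P: groupoid "Pi1 C" by (rule groupoid_Pi1)

abbreviation "p \<equiv> On_arr (Pi1_incl C)"
abbreviation "p_inv f \<equiv> inverse_arrow (Pi1 C) (p f)"

lemma l_functor: "is_functor (Pi1 C) C l"
  using adj by (simp add: adjunction_def)

lemmas l_obj = is_functorD(1)[OF l_functor, simplified]
lemmas l_arr = is_functorD(2)[OF l_functor]
lemmas l_id = is_functorD(3)[OF l_functor, simplified]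
lemmas l_comp = is_functorD(4)[OF l_functor]
lemmas p_id = is_functorD(3)[OF functor_Pi1_incl]
lemmas p_comp = is_functorD(4)[OF functor_Pi1_incl]

lemma counit_in: "x \<in> Obj C \<Longrightarrow> \<epsilon> x \<in> Hom C (On_obj l x) x"
  using adj by (auto simp: adjunction_def nat_trans_def comp_functor_def id_functor_def)

lemma unit_in: "x \<in> Obj C \<Longrightarrow> \<eta> x \<in> Hom (Pi1 C) x (On_obj l x)"
  using adj l_obj by (auto simp: adjunction_def nat_trans_def comp_functor_def id_functor_def)

lemma counit_natural:
  assumes "f \<in> Hom C x y"
  shows "Comp C (\<epsilon> y) (On_arr l (p f)) = Comp C f (\<epsilon> x)"
proof -
  have "Comp C (\<epsilon> y) (On_arr (comp_functor C l (Pi1_incl C)) f) =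
      Comp C (On_arr (id_functor C) f) (\<epsilon> x)"
    using adj assms unfolding adjunction_def nat_trans_def by blast
  then show ?thesis
    using Hom_ObjD[OF assms] by (simp add: comp_functor_def id_functor_def)
qed

lemma unit_natural:
  assumes "a \<in> Hom (Pi1 C) x y"
  shows "Comp (Pi1 C) (\<eta> y) a = Comp (Pi1 C) (p (On_arr l a)) (\<eta> x)"
proof -
  have "Comp (Pi1 C) (\<eta> y) (On_arr (id_functor (Pi1 C)) a) =
      Comp (Pi1 C) (On_arr (comp_functor (Pi1 C) (Pi1_incl C) l) a) (\<eta> x)"
    using adj assms unfolding adjunction_def nat_trans_def by blast
  then show ?thesis
    using P.Hom_ObjD[OF assms] by (simp add: comp_functor_def id_functor_def)
qed

lemma triangle_l: "x \<in> Obj C \<Longrightarrow> Comp C (\<epsilon> (On_obj l x)) (On_arr l (\<eta> x)) = Ide C (On_obj l x)"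
  using adj by (simp add: adjunction_def)

lemma triangle_p: "x \<in> Obj C \<Longrightarrow> Comp (Pi1 C) (p (\<epsilon> x)) (\<eta> x) = Ide (Pi1 C) x"
  using adj by (simp add: adjunction_def)

lemma unit_eq_inverse:
  assumes "x \<in> Obj C"
  shows "\<eta> x = p_inv (\<epsilon> x)"
proof -
  have e: "p (\<epsilon> x) \<in> Hom (Pi1 C) (On_obj l x) x" using Pi1_incl_in[OF counit_in[OF assms]] .
  note i = P.inverse_arrow[OF e]
  show ?thesis
    using P.inverse_unique[OF e i(1) unit_in[OF assms] i(2) triangle_p[OF assms]] by simp
qed

text \<open>Transposition along the adjunction is injective, since \<open>h\<close> is the transpose \<open>\<epsilon> y \<circ> l (p h \<circ> \<eta> x)\<close>
  of its own transpose.\<close>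

lemma transpose_inj:
  assumes "x \<in> Obj C" "h \<in> Hom C (On_obj l x) y" "h' \<in> Hom C (On_obj l x) y"
    and eq: "Comp (Pi1 C) (p h) (\<eta> x) = Comp (Pi1 C) (p h') (\<eta> x)"
  shows "h = h'"
proof -
  have "k = Comp C (\<epsilon> y) (On_arr l (Comp (Pi1 C) (p k) (\<eta> x)))" if k: "k \<in> Hom C (On_obj l x) y" for k
  proof -
    note u = unit_in[OF assms(1)] and pk = Pi1_incl_in[OF k]
    have y: "y \<in> Obj C" using Hom_ObjD[OF k] by simp
    have "Comp C (\<epsilon> y) (On_arr l (Comp (Pi1 C) (p k) (\<eta> x))) =
        Comp C (Comp C k (\<epsilon> (On_obj l x))) (On_arr l (\<eta> x))"
      using l_comp[OF u pk] Comp_assoc[OF l_arr[OF u] l_arr[OF pk] counit_in[OF y]]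
        counit_natural[OF k] by simp
    also have "\<dots> = k"
      using Comp_assoc[OF l_arr[OF u] counit_in[OF l_obj[OF assms(1)]] k] triangle_l[OF assms(1)]
        Comp_Ide_right[OF k] by simp
    finally show ?thesis by simp
  qed
  from this[OF assms(2)] this[OF assms(3)] eq show ?thesis by simp
qed

lemma l_p_inv:
  assumes f: "f \<in> Hom C x y"
  shows "On_arr l (p_inv f) \<in> Hom C (On_obj l y) (On_obj l x)"
    and "Comp C (On_arr l (p f)) (On_arr l (p_inv f)) = Ide C (On_obj l y)"
proof -
  note pf = Pi1_incl_in[OF f]
  note i = P.inverse_arrow[OF pf]
  show "On_arr l (p_inv f) \<in> Hom C (On_obj l y) (On_obj l x)" using l_arr[OF i(1)] .
  show "Comp C (On_arr l (p f)) (On_arr l (p_inv f)) = Ide C (On_obj l y)"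
    using l_comp[OF i(1) pf] i(3) l_id Hom_ObjD[OF f] by simp
qed

lemma adjoint_rot_eq:
  "f \<in> Hom C x y \<Longrightarrow> adjoint_rot C l \<epsilon> f = Comp C (\<epsilon> x) (On_arr l (p_inv f))"
  by (simp add: adjoint_rot_def Hom_def)

lemma adjoint_rot_Ide:
  assumes x: "x \<in> Obj C"
  shows "adjoint_rot C l \<epsilon> (Ide C x) = \<epsilon> x"
proof -
  have I: "Ide (Pi1 C) x \<in> Hom (Pi1 C) x x" using P.Ide_in x by simp
  note i = P.inverse_arrow[OF I]
  have "p (Ide C x) = Ide (Pi1 C) x" using p_id[OF x] x by simp
  moreover have "inverse_arrow (Pi1 C) (Ide (Pi1 C) x) = Ide (Pi1 C) x"
    using P.Comp_Ide_right[OF i(1)] i(2) by simp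
  ultimately show ?thesis
    using adjoint_rot_eq[OF Ide_in[OF x]] l_id[OF x] Comp_Ide_right[OF counit_in[OF x]] by simp
qed

text \<open>The first identity is naturality of \<open>\<epsilon>\<close> together with \<open>p f \<circ> (p (g \<circ> f))\<^sup>-\<^sup>1 = (p g)\<^sup>-\<^sup>1\<close>. The second is
  a triangle identity, since \<open>(p (\<epsilon> x))\<^sup>-\<^sup>1\<close> is the unit at \<open>x\<close>.\<close>

lemma rotation: "rotation C (On_obj l) (adjoint_rot C l \<epsilon>)"
proof unfold_locales
  fix f x y assume f: "f \<in> Hom C x y"
  show "adjoint_rot C l \<epsilon> f \<in> Hom C (On_obj l y) x"
    using Comp_in[OF l_p_inv(1)[OF f] counit_in] Hom_ObjD[OF f] adjoint_rot_eq[OF f] by simp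
next
  fix f g x y z assume f: "f \<in> Hom C x y" and g: "g \<in> Hom C y z"
  let ?l = "On_arr l" and ?gf = "Comp C g f"
  note xyz = Hom_ObjD[OF f] Hom_ObjD[OF g]
  note gf = Comp_in[OF f g]
  note pf = Pi1_incl_in[OF f] and pg = Pi1_incl_in[OF g]
  note ig = P.inverse_arrow[OF pg] and igf = P.inverse_arrow[OF Pi1_incl_in[OF gf]]
  have c: "Comp (Pi1 C) (p f) (p_inv ?gf) = p_inv g"
  proof -
    have "Comp (Pi1 C) (p g) (Comp (Pi1 C) (p f) (p_inv ?gf)) = Ide (Pi1 C) z"
      using P.Comp_assoc[OF igf(1) pf pg] p_comp[OF f g] igf(3) by simp
    from P.inverse_unique[OF pg ig(1) P.Comp_in[OF igf(1) pf] ig(2) this]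
    show ?thesis by simp
  qed
  have "Comp C f (adjoint_rot C l \<epsilon> ?gf) = Comp C (Comp C f (\<epsilon> x)) (?l (p_inv ?gf))"
    using Comp_assoc[OF l_arr[OF igf(1)] counit_in f] xyz adjoint_rot_eq[OF gf] by simp
  also have "\<dots> = Comp C (\<epsilon> y) (Comp C (?l (p f)) (?l (p_inv ?gf)))"
    using Comp_assoc[OF l_arr[OF igf(1)] l_arr[OF pf] counit_in] xyz counit_natural[OF f] by simp
  also have "\<dots> = adjoint_rot C l \<epsilon> g"
    using l_comp[OF igf(1) pf] c adjoint_rot_eq[OF g] by simp
  finally show "Comp C f (adjoint_rot C l \<epsilon> ?gf) = adjoint_rot C l \<epsilon> g" .
next
  fix x assume x: "x \<in> Obj C"
  show "adjoint_rot C l \<epsilon> (adjoint_rot C l \<epsilon> (Ide C x)) = Ide C (On_obj l x)"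
    unfolding adjoint_rot_Ide[OF x]
    using adjoint_rot_eq[OF counit_in[OF x]] unit_eq_inverse[OF x] triangle_l[OF x] by simp
qed

end

text \<open>The unit is inverse to \<open>p \<epsilon>\<close>, and by its naturality \<open>l a\<close> is the unique arrow with
  \<open>p (l a) \<circ> \<eta> x = \<eta> y \<circ> a\<close>.\<close>

lemma adjunction_unique:
  assumes "category C"
    and adj: "adjunction C (Pi1 C) l (Pi1_incl C) \<eta> \<epsilon>" "adjunction C (Pi1 C) l' (Pi1_incl C) \<eta>' \<epsilon>'"
    and obj: "\<And>x. x \<in> Obj C \<Longrightarrow> On_obj l x = On_obj l' x"
    and counit: "\<And>x. x \<in> Obj C \<Longrightarrow> \<epsilon> x = \<epsilon>' x"
  shows "(l, \<eta>, \<epsilon>) = (l', \<eta>', \<epsilon>')"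
proof -
  interpret A: Pi1_left_adjoint C l \<eta> \<epsilon>
    using assms by (simp add: Pi1_left_adjoint_def Pi1_left_adjoint_axioms_def)
  interpret B: Pi1_left_adjoint C l' \<eta>' \<epsilon>'
    using assms by (simp add: Pi1_left_adjoint_def Pi1_left_adjoint_axioms_def)
  have unit: "\<eta> x = \<eta>' x" if "x \<in> Obj C" for x
    using A.unit_eq_inverse[OF that] B.unit_eq_inverse[OF that] counit[OF that] by simp
  have arr: "On_arr l a = On_arr l' a" if "a \<in> Arr (Pi1 C)" for a
  proof -
    define x y where "x = Dom (Pi1 C) a" and "y = Cod (Pi1 C) a"
    then have a: "a \<in> Hom (Pi1 C) x y" using that by (simp add: Hom_def)
    then have xy: "x \<in> Obj C" "y \<in> Obj C" using A.P.Hom_ObjD[OF a] by auto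
    show ?thesis
      using A.l_arr[OF a] B.l_arr[OF a] A.unit_natural[OF a] B.unit_natural[OF a] xy obj unit
      by (intro A.transpose_inj[OF xy(1)]) auto
  qed
  have "On_obj l \<in> extensional (Obj C)" "On_obj l' \<in> extensional (Obj C)"
    "On_arr l \<in> extensional (Arr (Pi1 C))" "On_arr l' \<in> extensional (Arr (Pi1 C))"
    using A.l_functor B.l_functor by (auto simp: is_functor_def PiE_def)
  then have "l = l'"
    using obj arr by (intro cat_functor.equality) (auto intro: extensionalityI)
  moreover have "\<eta> \<in> extensional (Obj C)" "\<eta>' \<in> extensional (Obj C)"
    "\<epsilon> \<in> extensional (Obj C)" "\<epsilon>' \<in> extensional (Obj C)"
    using adj by (auto simp: adjunction_def nat_trans_def)
  then have "\<eta> = \<eta>'" "\<epsilon> = \<epsilon>'" using unit counit by (auto intro: extensionalityI)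
  ultimately show ?thesis by simp
qed

section \<open>The equivalence\<close>

context rotation
begin

lemma rotate_chain_Ide:
  assumes "x \<in> Obj C"
  shows "rotate_chain C T \<tau> 1 ([x, x], [Ide C x]) = ([T x, x], [counit x])"
proof -
  have "path C 1 (\<lambda>_. x) (\<lambda>_. Ide C x)" using assms Ide_in by (simp add: path_def)
  from rotate_chain_of[OF this, of T \<tau>] show ?thesis
    using Comp_Ide_right[OF Ide_in[OF assms]] by (simp add: chain_of_def counit_def)
qed

end

definition adjoint_duplicial :: "('o, 'm) cat \<Rightarrow>
    ('o, ('o, 'm) zz_arrow, 'o, 'm) cat_functor \<times> ('o \<Rightarrow> ('o, 'm) zz_arrow) \<times> ('o \<Rightarrow> 'm) \<Rightarrow>
    nat \<Rightarrow> ('o, 'm) chain \<Rightarrow> ('o, 'm) chain" where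
  "adjoint_duplicial C = (\<lambda>(l, \<eta>, \<epsilon>). rotate_chain C (On_obj l) (adjoint_rot C l \<epsilon>))"

text \<open>Let \<open>l\<close> be the left adjoint built from the rotation of \<open>t\<close>. Then \<open>\<epsilon> x = \<tau> f \<circ> \<tau> (\<tau> f)\<close> and
  \<open>\<tau> (\<tau> f) = l (p f)\<close>, so \<open>\<epsilon> x \<circ> l ((p f)\<^sup>-\<^sup>1) = \<tau> f\<close>.\<close>

lemma adjoint_duplicial_surj:
  assumes "category C" "duplicial_structure (nerve C) t"
  shows "\<exists>l \<eta> \<epsilon>. adjunction C (Pi1 C) l (Pi1_incl C) \<eta> \<epsilon> \<and> adjoint_duplicial C (l, \<eta>, \<epsilon>) = t"
proof -
  interpret duplicial_nerve C t
    using assms by (simp add: duplicial_nerve_def duplicial_nerve_axioms_def)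
  interpret R: rotation C rot_obj rot_arr by (rule rotation)
  obtain l \<eta> \<epsilon> where adj: "adjunction C (Pi1 C) l (Pi1_incl C) \<eta> \<epsilon>"
    and l: "\<And>x. x \<in> Obj C \<Longrightarrow> On_obj l x = rot_obj x"
    and \<epsilon>: "\<And>x. x \<in> Obj C \<Longrightarrow> \<epsilon> x = R.counit x"
    and lp: "\<And>f x y. f \<in> Hom C x y \<Longrightarrow> On_arr l (On_arr (Pi1_incl C) f) = rot_arr (rot_arr f)"
    using R.ex_left_adjoint by blast
  interpret A: Pi1_left_adjoint C l \<eta> \<epsilon>
    using assms adj by (simp add: Pi1_left_adjoint_def Pi1_left_adjoint_axioms_def)
  have "adjoint_rot C l \<epsilon> f = rot_arr f" if "f \<in> Arr C" for f
  proof -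
    define x y where "x = Dom C f" and "y = Cod C f"
    then have f: "f \<in> Hom C x y" using that by (simp add: Hom_def)
    note xy = Hom_ObjD[OF f] and r = R.rot_in[OF f]
    have i: "On_arr l (A.p_inv f) \<in> Hom C (rot_obj y) (rot_obj x)"
      "Comp C (rot_arr (rot_arr f)) (On_arr l (A.p_inv f)) = Ide C (rot_obj y)"
      using A.l_p_inv[OF f] xy l by (simp_all add: lp[OF f])
    have "adjoint_rot C l \<epsilon> f =
        Comp C (Comp C (rot_arr f) (rot_arr (rot_arr f))) (On_arr l (A.p_inv f))"
      using A.adjoint_rot_eq[OF f] \<epsilon> xy R.rot_comp[OF r] by (simp add: R.counit_def)
    also have "\<dots> = rot_arr f"
      using Comp_assoc[OF i(1) R.rot_in[OF r] r, symmetric] i(2) Comp_Ide_right[OF r] by simp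
    finally show ?thesis .
  qed
  then have "rotate_chain C (On_obj l) (adjoint_rot C l \<epsilon>) n = rotate_chain C rot_obj rot_arr n" for n
    using l by (intro rotate_chain_cong[OF assms(1)])
  then have "adjoint_duplicial C (l, \<eta>, \<epsilon>) = rotate_chain C rot_obj rot_arr"
    by (simp add: adjoint_duplicial_def ext)
  also have "\<dots> = t" by (rule t_eq_rotate_chain[symmetric])
  finally have "adjoint_duplicial C (l, \<eta>, \<epsilon>) = t" .
  then show ?thesis using adj by blast
qed

lemma
  assumes "category C" "adjunction C (Pi1 C) l (Pi1_incl C) \<eta> \<epsilon>"
  shows adjoint_duplicial: "duplicial_structure (nerve C) (adjoint_duplicial C (l, \<eta>, \<epsilon>))"
    and adjoint_duplicial_Ide:
      "x \<in> Obj C \<Longrightarrow> adjoint_duplicial C (l, \<eta>, \<epsilon>) 1 ([x, x], [Ide C x]) = ([On_obj l x, x], [\<epsilon> x])"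
proof -
  interpret Pi1_left_adjoint C l \<eta> \<epsilon>
    using assms by (simp add: Pi1_left_adjoint_def Pi1_left_adjoint_axioms_def)
  interpret R: rotation C "On_obj l" "adjoint_rot C l \<epsilon>" by (rule rotation)
  show "duplicial_structure (nerve C) (adjoint_duplicial C (l, \<eta>, \<epsilon>))"
    using R.duplicial_rotate_chain by (simp add: adjoint_duplicial_def)
  show "x \<in> Obj C \<Longrightarrow> adjoint_duplicial C (l, \<eta>, \<epsilon>) 1 ([x, x], [Ide C x]) = ([On_obj l x, x], [\<epsilon> x])"
    using R.rotate_chain_Ide adjoint_rot_Ide by (simp add: adjoint_duplicial_def R.counit_def)
qed

text \<open>The bijection is constructed in the direction from adjunctions to duplicial structures, where no
  choices are made, and then inverted.\<close>

theorem theorem5p2: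
  fixes C :: "('o, 'm) cat"
  assumes "category C"
  shows "\<exists>\<Phi>. bij_betw \<Phi>
      {t. duplicial_structure (nerve C) t}
      {(l, \<eta>, \<epsilon>). adjunction C (Pi1 C) l (Pi1_incl C) \<eta> \<epsilon>} \<and>
    (\<forall>t l \<eta> \<epsilon>. duplicial_structure (nerve C) t \<longrightarrow> \<Phi> t = (l, \<eta>, \<epsilon>) \<longrightarrow>
      (\<forall>x \<in> Obj C. t 1 ([x, x], [Ide C x]) = ([On_obj l (On_obj (Pi1_incl C) x), x], [\<epsilon> x])))"
proof -
  let ?D = "{t. duplicial_structure (nerve C) t}"
    and ?A = "{(l, \<eta>, \<epsilon>). adjunction C (Pi1 C) l (Pi1_incl C) \<eta> \<epsilon>}"
    and ?\<Psi> = "adjoint_duplicial C"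
  have "inj_on ?\<Psi> ?A"
  proof (rule inj_onI)
    fix u v assume "u \<in> ?A" "v \<in> ?A" and uv: "?\<Psi> u = ?\<Psi> v"
    then obtain l \<eta> \<epsilon> l' \<eta>' \<epsilon>' where u: "u = (l, \<eta>, \<epsilon>)" and v: "v = (l', \<eta>', \<epsilon>')"
      and adj: "adjunction C (Pi1 C) l (Pi1_incl C) \<eta> \<epsilon>"
        "adjunction C (Pi1 C) l' (Pi1_incl C) \<eta>' \<epsilon>'"
      by auto
    note Ide = adjoint_duplicial_Ide[OF assms adj(1)] adjoint_duplicial_Ide[OF assms adj(2)]
    have "On_obj l x = On_obj l' x \<and> \<epsilon> x = \<epsilon>' x" if "x \<in> Obj C" for x
      using Ide[OF that] uv unfolding u v by simp
    then show "u = v"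
      unfolding u v using adjunction_unique[OF assms adj] by blast
  qed
  moreover have "?\<Psi> ` ?A = ?D"
    using adjoint_duplicial[OF assms] adjoint_duplicial_surj[OF assms] by (force simp: image_iff)
  ultimately have bij: "bij_betw ?\<Psi> ?A ?D" by (simp add: bij_betw_def)
  let ?\<Phi> = "inv_into ?A ?\<Psi>"
  have "t 1 ([x, x], [Ide C x]) = ([On_obj l (On_obj (Pi1_incl C) x), x], [\<epsilon> x])"
    if "t \<in> ?D" "?\<Phi> t = (l, \<eta>, \<epsilon>)" "x \<in> Obj C" for t l \<eta> \<epsilon> x
  proof -
    have "(l, \<eta>, \<epsilon>) \<in> ?A"
      using bij_betw_apply[OF bij_betw_inv_into[OF bij] that(1)] unfolding that(2) .
    moreover have "?\<Psi> (l, \<eta>, \<epsilon>) = t"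
      using bij_betw_inv_into_right[OF bij that(1)] unfolding that(2) .
    ultimately show ?thesis
      using adjoint_duplicial_Ide[OF assms _ that(3), of l \<eta> \<epsilon>] that(3) by simp
  qed
  with bij_betw_inv_into[OF bij] show ?thesis by (intro exI[of _ ?\<Phi>] conjI) simp_all
qed

end
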